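(* Let $M$ be the chain coalgebra over $\mathbb F_2$ with basis $\{1_0,u_2,x_3,y_3,z_3,v_4,w_6\}$ (subscripts indicate degree), whose only non-zero differential on basis elements is $\partial(v)=x+y$, and whose comultiplication $\psi$ is such that all basis elements of positive degree other than $v$ and $w$ are primitive, while the reduced comultiplication satisfies $\overline\psi(v)=u\otimes u$ and $\overline\psi(w)=x\otimes z+z\otimes y$. Then $M$ is not realizable, i.e., $M$ is not of the same homotopy type as $C_*(X;\mathbb F_2)$ for any space $X$.
   Context: $C_*(X;\mathbb F_2)$ denotes the chains on $X$ with $\mathbb F_2$ coefficients, with its usual (Alexander-Whitney) coassociative comultiplication. Two chain coalgebras have the same homotopy type if they are connected by a (zig-zag) sequence of chain coalgebra quasi-isomorphisms. The full comultiplication is $\psi(1)=1\otimes1$ and $\psi(a)=a\otimes1+1\otimes a+\overline\psi(a)$ for $a$ of positive degree; $a$ is primitive if $\overline\psi(a)=0$. $(M,\partial,\psi)$ is a coassociative chain coalgebra. *)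

theory Defs
  imports "HOL-Homology.Homology" "HOL-Library.Z2"
begin

section \<open>Chain coalgebras over the field with two elements\<close>

text \<open>
  The \<open>\<F>\<^sub>2\<close>-vector space with basis a set \<open>B\<close> of elements of \<open>'b\<close> consists of the
  \<open>x :: 'b \<Rightarrow>\<^sub>0 bit\<close> with \<open>keys x \<subseteq> B\<close>, and its tensor square is the space with basis \<open>B \<times> B\<close>.
  As every graded vector space has a homogeneous basis, describing a chain coalgebra by a
  homogeneous basis and the values of its structure maps on that basis is no restriction; morphisms
  are arbitrary linear maps and need not respect the bases.
\<close>

abbreviation gen :: "'b \<Rightarrow> ('b \<Rightarrow>\<^sub>0 bit)"
  where "gen b \<equiv> Poly_Mapping.single b 1"

text \<open>Linear extension of a map given on basis elements; every non-zero coefficient is 1.\<close>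

definition lin :: "('b \<Rightarrow> ('c \<Rightarrow>\<^sub>0 bit)) \<Rightarrow> ('b \<Rightarrow>\<^sub>0 bit) \<Rightarrow> ('c \<Rightarrow>\<^sub>0 bit)"
  where "lin f x = (\<Sum>b\<in>Poly_Mapping.keys x. f b)"

definition tensor :: "('b \<Rightarrow>\<^sub>0 bit) \<Rightarrow> ('c \<Rightarrow>\<^sub>0 bit) \<Rightarrow> ('b \<times> 'c \<Rightarrow>\<^sub>0 bit)"
  where "tensor x y = (\<Sum>b\<in>Poly_Mapping.keys x. \<Sum>c\<in>Poly_Mapping.keys y. gen (b, c))"

definition tensor_map ::
    "('a \<Rightarrow> ('c \<Rightarrow>\<^sub>0 bit)) \<Rightarrow> ('b \<Rightarrow> ('d \<Rightarrow>\<^sub>0 bit)) \<Rightarrow> ('a \<times> 'b \<Rightarrow>\<^sub>0 bit) \<Rightarrow> ('c \<times> 'd \<Rightarrow>\<^sub>0 bit)"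
  where "tensor_map f g = lin (\<lambda>(a, b). tensor (f a) (g b))"

definition tensor_assoc :: "(('a \<times> 'b) \<times> 'c \<Rightarrow>\<^sub>0 bit) \<Rightarrow> ('a \<times> 'b \<times> 'c \<Rightarrow>\<^sub>0 bit)"
  where "tensor_assoc = lin (\<lambda>((a, b), c). gen (a, b, c))"

record 'b chain_coalg =
  basis :: "'b set"
  deg :: "'b \<Rightarrow> nat"
  bdry :: "'b \<Rightarrow> ('b \<Rightarrow>\<^sub>0 bit)"
  comult :: "'b \<Rightarrow> ('b \<times> 'b \<Rightarrow>\<^sub>0 bit)"

definition chains :: "'b chain_coalg \<Rightarrow> nat \<Rightarrow> ('b \<Rightarrow>\<^sub>0 bit) set"
  where "chains C n = {x. Poly_Mapping.keys x \<subseteq> {b \<in> basis C. deg C b = n}}"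

text \<open>No signs occur in the differential \<open>\<partial> \<otimes> 1 + 1 \<otimes> \<partial>\<close> of the tensor square, as the
  characteristic is 2.\<close>

definition chain_coalgebra :: "'b chain_coalg \<Rightarrow> bool"
  where "chain_coalgebra C \<longleftrightarrow>
    (\<forall>b\<in>basis C.
       Poly_Mapping.keys (bdry C b) \<subseteq> {c \<in> basis C. Suc (deg C c) = deg C b} \<and>
       Poly_Mapping.keys (comult C b)
         \<subseteq> {(c, d). c \<in> basis C \<and> d \<in> basis C \<and> deg C c + deg C d = deg C b} \<and>
       lin (bdry C) (bdry C b) = 0 \<and>
       lin (comult C) (bdry C b)
         = tensor_map (bdry C) gen (comult C b) + tensor_map gen (bdry C) (comult C b) \<and>
       tensor_assoc (tensor_map (comult C) gen (comult C b))
         = tensor_map gen (comult C) (comult C b))"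

definition coalg_hom ::
    "'b chain_coalg \<Rightarrow> 'c chain_coalg \<Rightarrow> ('b \<Rightarrow> ('c \<Rightarrow>\<^sub>0 bit)) \<Rightarrow> bool"
  where "coalg_hom C D f \<longleftrightarrow>
    (\<forall>b\<in>basis C.
       f b \<in> chains D (deg C b) \<and>
       lin f (bdry C b) = lin (bdry D) (f b) \<and>
       tensor_map f f (comult C b) = lin (comult D) (f b))"


section \<open>Homology and homotopy types\<close>

definition cycles :: "'b chain_coalg \<Rightarrow> nat \<Rightarrow> ('b \<Rightarrow>\<^sub>0 bit) set"
  where "cycles C n = {x \<in> chains C n. lin (bdry C) x = 0}"

definition boundaries :: "'b chain_coalg \<Rightarrow> nat \<Rightarrow> ('b \<Rightarrow>\<^sub>0 bit) set"
  where "boundaries C n = lin (bdry C) ` chains C (Suc n)"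

definition homologous :: "'b chain_coalg \<Rightarrow> nat \<Rightarrow> ('b \<Rightarrow>\<^sub>0 bit) rel"
  where "homologous C n = {(x, y). x \<in> cycles C n \<and> y \<in> cycles C n \<and> x - y \<in> boundaries C n}"

definition homology :: "'b chain_coalg \<Rightarrow> nat \<Rightarrow> ('b \<Rightarrow>\<^sub>0 bit) set set"
  where "homology C n = cycles C n // homologous C n"

definition homology_map ::
    "'c chain_coalg \<Rightarrow> ('b \<Rightarrow> ('c \<Rightarrow>\<^sub>0 bit)) \<Rightarrow> nat \<Rightarrow> ('b \<Rightarrow>\<^sub>0 bit) set \<Rightarrow> ('c \<Rightarrow>\<^sub>0 bit) set"
  where "homology_map D f n h = homologous D n `` (lin f ` h)"

definition coalg_quasi_iso :: "'b chain_coalg \<Rightarrow> 'c chain_coalg \<Rightarrow> bool"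
  where "coalg_quasi_iso C D \<longleftrightarrow>
    chain_coalgebra C \<and> chain_coalgebra D \<and>
    (\<exists>f. coalg_hom C D f \<and> (\<forall>n. bij_betw (homology_map D f n) (homology C n) (homology D n)))"

text \<open>
  \<open>A\<close> and \<open>B\<close> are joined by a finite zig-zag of quasi-isomorphisms, in either direction, through
  chain coalgebras with bases in \<open>'c\<close>.  Finitely many types embed into a common one, so
  letting \<open>'c\<close> vary over all types covers all zig-zags; direct maps between \<open>A\<close> and \<open>B\<close> are
  covered through identities.
\<close>

definition same_homotopy_type :: "'c itself \<Rightarrow> 'a chain_coalg \<Rightarrow> 'b chain_coalg \<Rightarrow> bool"
  where "same_homotopy_type TYPE('c) A B \<longleftrightarrow>
    (\<exists>C D :: 'c chain_coalg.
       (coalg_quasi_iso A C \<or> coalg_quasi_iso C A) \<and>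
       equivclp coalg_quasi_iso C D \<and>
       (coalg_quasi_iso D B \<or> coalg_quasi_iso B D))"


section \<open>Singular chains with the Alexander-Whitney comultiplication\<close>

text \<open>
  The standard \<open>i\<close>-simplex is the face of the standard \<open>n\<close>-simplex on its first \<open>i + 1\<close> vertices,
  and \<open>\<lambda>k. if k < i then 0 else t (k - i)\<close> includes the standard \<open>m\<close>-simplex into the standard
  \<open>(i + m)\<close>-simplex as the face on the last \<open>m + 1\<close> vertices.
\<close>

definition front_face :: "nat \<Rightarrow> ((nat \<Rightarrow> real) \<Rightarrow> 'a) \<Rightarrow> (nat \<Rightarrow> real) \<Rightarrow> 'a"
  where "front_face i s = restrict s (standard_simplex i)"

definition back_face :: "nat \<Rightarrow> nat \<Rightarrow> ((nat \<Rightarrow> real) \<Rightarrow> 'a) \<Rightarrow> (nat \<Rightarrow> real) \<Rightarrow> 'a"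
  where "back_face i m s = restrict (\<lambda>t. s (\<lambda>k. if k < i then 0 else t (k - i))) (standard_simplex m)"

text \<open>Basis elements carry their dimension, since the function representing a singular simplex
  need not determine it.\<close>

definition singular_coalg :: "'a topology \<Rightarrow> (nat \<times> ((nat \<Rightarrow> real) \<Rightarrow> 'a)) chain_coalg"
  where "singular_coalg X =
    \<lparr> basis = {(n, s). singular_simplex n X s},
      deg = fst,
      bdry = (\<lambda>(n, s). if n = 0 then 0 else \<Sum>k\<le>n. gen (n - 1, singular_face n k s)),
      comult = (\<lambda>(n, s). \<Sum>i\<le>n. gen ((i, front_face i s), (n - i, back_face i (n - i) s))) \<rparr>"


section \<open>The chain coalgebra M\<close>

datatype M_basis = One0 | U2 | X3 | Y3 | Z3 | V4 | W6

fun M_deg :: "M_basis \<Rightarrow> nat" where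
  "M_deg One0 = 0"
| "M_deg U2 = 2"
| "M_deg X3 = 3"
| "M_deg Y3 = 3"
| "M_deg Z3 = 3"
| "M_deg V4 = 4"
| "M_deg W6 = 6"

definition M_bdry :: "M_basis \<Rightarrow> (M_basis \<Rightarrow>\<^sub>0 bit)"
  where "M_bdry b = (if b = V4 then gen X3 + gen Y3 else 0)"

fun M_reduced_comult :: "M_basis \<Rightarrow> (M_basis \<times> M_basis \<Rightarrow>\<^sub>0 bit)" where
  "M_reduced_comult V4 = gen (U2, U2)"
| "M_reduced_comult W6 = gen (X3, Z3) + gen (Z3, Y3)"
| "M_reduced_comult _ = 0"

definition M_comult :: "M_basis \<Rightarrow> (M_basis \<times> M_basis \<Rightarrow>\<^sub>0 bit)"
  where "M_comult b =
    (if b = One0 then gen (One0, One0)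
     else gen (b, One0) + gen (One0, b) + M_reduced_comult b)"

definition M_coalg :: "M_basis chain_coalg"
  where "M_coalg = \<lparr> basis = UNIV, deg = M_deg, bdry = M_bdry, comult = M_comult \<rparr>"

end

theory Submission
  imports Defs "HOL-Library.Function_Algebras"
begin

text \<open>
  The obstruction is a secondary operation on the cohomology algebra, visible in the dual
  differential graded algebra. Let \<open>u\<close> and \<open>z\<close> be cocycles with \<open>u\<^sup>2 = d x\<close> and \<open>[u, z] = d c\<close>. In
  characteristic 2 the element \<open>[x, z] + [u, c]\<close> is a cocycle. If cohomology is commutative, its
  class depends on the classes of \<open>u\<close> and \<open>z\<close> only (\<open>bracket_change\<close>), so its vanishing is
  preserved and reflected by quasi-isomorphisms of algebras (\<open>preserves\<close>, \<open>reflects\<close>). Over a field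
  a quasi-isomorphism of coalgebras dualises to one of algebras (\<open>dg_quasi_iso2_dual\<close>). Hence
  vanishing of the operation, together with commutativity of cohomology, is an invariant of the
  homotopy type (\<open>same_homotopy_type_iff\<close>).

  For the singular cochains of a space the operation vanishes: the cup-1 product is a homotopy for
  commutativity (\<open>cup1_leibniz\<close>), and it is a derivation in its first argument by the
  Hirsch formula (\<open>hirsch\<close>). So \<open>[x, z]\<close> is cohomologous to \<open>u\<^sup>2\<close> cup-1 \<open>z\<close>, that is to
  \<open>[u, u\<close> cup-1 \<open>z]\<close>, and the rest is a commutator of cocycles.

  In the dual of \<open>M\<close> take for \<open>u\<close>, \<open>z\<close>, \<open>x\<close> the dual basis elements of the same names and \<open>c = 0\<close>.
  The operation gives the dual of \<open>w\<close>, since the comultiplication of \<open>w\<close> contains \<open>x \<otimes> z\<close>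
  but not \<open>z \<otimes> x\<close>, and no coboundary takes a non-zero value on \<open>w\<close> (\<open>M_not_square_bracket_trivial\<close>).

  All cochains are inhomogeneous. The operation makes sense without a grading in
  characteristic 2, and the homology of the total chains is the direct sum of the homology groups in
  all degrees.
\<close>

section \<open>Vectors over the field with two elements\<close>

text \<open>The default rules turn sums and products of bits into boolean operations; ring
  arithmetic is wanted here.\<close>

declare add_bit_eq_xor [simp del] mult_bit_eq_and [simp del]

lemma bit_double [simp]: "(a::bit) + a = 0"
  by (cases a) simp_all

lemma bit_cancel [simp]: "(a::bit) + (a + b) = b"
  by (cases a; cases b) simp_all

lemma poly_double [simp]: "(x :: 'b \<Rightarrow>\<^sub>0 bit) + x = 0"
  by (rule poly_mapping_eqI) (simp add: lookup_add)

lemma poly_cancel [simp]: "(x :: 'b \<Rightarrow>\<^sub>0 bit) + (x + y) = y"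
  by (simp flip: add.assoc)

lemma poly_minus: "(x :: 'b \<Rightarrow>\<^sub>0 bit) - y = x + y"
  by (rule poly_mapping_eqI) (simp add: lookup_add lookup_minus)

lemma keys_sum_subset: "(\<And>i. i \<in> I \<Longrightarrow> Poly_Mapping.keys (f i) \<subseteq> A) \<Longrightarrow> Poly_Mapping.keys (sum f I) \<subseteq> A"
  by (induction I rule: infinite_finite_induct) (use keys_add in \<open>fastforce simp: subset_iff\<close>)+

lemma keys_add_subset: "Poly_Mapping.keys x \<subseteq> A \<Longrightarrow> Poly_Mapping.keys y \<subseteq> A \<Longrightarrow> Poly_Mapping.keys (x + y) \<subseteq> A"
  using keys_add by fastforce

lemma F2_induct [consumes 1, case_names zero gen add]:
  assumes "Poly_Mapping.keys x \<subseteq> A"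
    and "P 0" and "\<And>b. b \<in> A \<Longrightarrow> P (gen b)"
    and "\<And>y z. Poly_Mapping.keys y \<subseteq> A \<Longrightarrow> Poly_Mapping.keys z \<subseteq> A \<Longrightarrow> P y \<Longrightarrow> P z \<Longrightarrow> P (y + z)"
  shows "P x"
proof -
  have *: "x = (\<Sum>b\<in>Poly_Mapping.keys x. gen b)"
    by (rule poly_mapping_eqI)
      (auto simp: lookup_sum lookup_single when_def in_keys_iff)
  have "finite B \<Longrightarrow> B \<subseteq> A \<Longrightarrow> P (\<Sum>b\<in>B. gen b)" for B
  proof (induction B rule: finite_induct)
    case (insert b B)
    then show ?case
      using assms(3,4) by (auto intro!: assms(4) keys_sum_subset)
  qed (simp add: assms(2))
  then show ?thesis
    using * assms(1) by (metis finite_keys)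
qed

subsection \<open>Evaluation of functions on vectors\<close>

text \<open>A function on a basis is the same as a linear functional, and \<open>ev\<close> is that functional. The value
  type is kept general so that linear extension of maps into another vector space is an instance.\<close>

definition ev :: "('b \<Rightarrow> 'v) \<Rightarrow> ('b \<Rightarrow>\<^sub>0 bit) \<Rightarrow> 'v::comm_monoid_add"
  where "ev f x = (\<Sum>b\<in>Poly_Mapping.keys x. f b)"

lemma ev_gen [simp]: "ev f (gen b) = f b"
  by (simp add: ev_def)

lemma ev_0 [simp]: "ev f 0 = 0"
  by (simp add: ev_def)

lemma ev_add:
  assumes "\<And>a::'v::comm_monoid_add. a + a = 0"
  shows "ev f (x + y) = ev f x + (ev f y :: 'v)"
proof -
  let ?K = "Poly_Mapping.keys x \<union> Poly_Mapping.keys y"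
  have *: "ev f z = (\<Sum>b\<in>?K. if Poly_Mapping.lookup z b = 1 then f b else 0)" if "Poly_Mapping.keys z \<subseteq> ?K" for z
    unfolding ev_def by (rule sum.mono_neutral_cong_left) (use that in \<open>auto simp: in_keys_iff\<close>)
  have "(if Poly_Mapping.lookup (x + y) b = 1 then f b else 0) =
      (if Poly_Mapping.lookup x b = 1 then f b else 0) + (if Poly_Mapping.lookup y b = 1 then f b else 0)" for b
    by (cases "Poly_Mapping.lookup x b"; cases "Poly_Mapping.lookup y b") (simp_all add: lookup_add assms)
  then show ?thesis
    by (subst (1 2 3) *) (use keys_add in \<open>fastforce simp: sum.distrib\<close>)+
qed

lemma ev_sum:
  assumes "\<And>a::'v::comm_monoid_add. a + a = 0"
  shows "ev f (\<Sum>i\<in>I. x i) = (\<Sum>i\<in>I. ev f (x i) :: 'v)"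
  by (induction I rule: infinite_finite_induct) (simp_all add: ev_add assms)

lemmas ev_bit_add [simp] = ev_add[of _ _ _, OF bit_double] and ev_bit_sum = ev_sum[OF bit_double]

lemma lin_ev: "lin = ev"
  by (simp add: fun_eq_iff lin_def ev_def)

lemma lin_add [simp]: "lin f (x + y) = lin f x + lin f y"
  and lin_0 [simp]: "lin f 0 = 0"
  and lin_gen [simp]: "lin f (gen b) = f b"
  by (simp_all add: lin_ev ev_add)

lemma lin_sum: "lin f (\<Sum>i\<in>I. x i) = (\<Sum>i\<in>I. lin f (x i))"
  by (simp add: lin_ev ev_sum)

lemma ev_cong: "Poly_Mapping.keys x \<subseteq> A \<Longrightarrow> (\<And>b. b \<in> A \<Longrightarrow> f b = g b) \<Longrightarrow> ev f x = ev g x"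
  unfolding ev_def by (rule sum.cong) auto

lemma ev_plus: "ev (f + g) x = ev f x + ev g x"
  by (simp add: ev_def sum.distrib)

lemma ev_lin: "ev \<phi> (lin f x) = (ev (\<lambda>b. ev \<phi> (f b)) x :: bit)"
  by (induction rule: F2_induct[OF subset_UNIV, of _ x]) simp_all

lemma keys_lin: "Poly_Mapping.keys x \<subseteq> A \<Longrightarrow> (\<And>b. b \<in> A \<Longrightarrow> Poly_Mapping.keys (f b) \<subseteq> B) \<Longrightarrow> Poly_Mapping.keys (lin f x) \<subseteq> B"
  unfolding lin_def by (rule keys_sum_subset) blast

text \<open>The functional on a tensor product that two functionals induce.\<close>

definition outer :: "('b \<Rightarrow> bit) \<Rightarrow> ('c \<Rightarrow> bit) \<Rightarrow> 'b \<times> 'c \<Rightarrow> bit"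
  where "outer \<phi> \<psi> = (\<lambda>(b, c). \<phi> b * \<psi> c)"

lemma ev_tensor: "ev (outer \<phi> \<psi>) (tensor x y) = ev \<phi> x * ev \<psi> y"
  by (simp add: tensor_def ev_bit_sum ev_def[of \<phi>] ev_def[of \<psi>] sum_product outer_def)

lemma ev_tensor_map: "ev (outer \<phi> \<psi>) (tensor_map f g x) = ev (outer (\<lambda>b. ev \<phi> (f b)) (\<lambda>b. ev \<psi> (g b))) x"
  unfolding tensor_map_def ev_lin by (simp add: ev_tensor case_prod_unfold) (simp add: outer_def case_prod_unfold)

lemma ev_tensor_assoc: "ev (outer \<phi> (outer \<psi> \<omega>)) (tensor_assoc x) = ev (outer (outer \<phi> \<psi>) \<omega>) x"
  unfolding tensor_assoc_def ev_lin by (simp add: outer_def case_prod_unfold mult.assoc)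

subsection \<open>Sections of additive maps\<close>

text \<open>Over a field every linear map splits. Additive groups of exponent two are vector spaces over
  the field with two elements, and additive maps between them are linear, so no scalars occur in the
  statement. Sections are what extends functionals from a subspace, such as the boundaries, to all
  chains, and so what makes cohomology the dual of homology.\<close>

lemma additive_section:
  fixes F :: "'v::ab_group_add \<Rightarrow> 'w::ab_group_add"
  assumes v: "\<And>a::'v. a + a = 0" and w: "\<And>a::'w. a + a = 0"
    and V: "0 \<in> V" "\<And>a b. a \<in> V \<Longrightarrow> b \<in> V \<Longrightarrow> a + b \<in> V"
    and F: "\<And>a b. F (a + b) = F a + F b"
  shows "\<exists>g. (\<forall>a b. g (a + b) = g a + g b) \<and> (\<forall>a. g a \<in> V) \<and> (\<forall>a\<in>V. F (g (F a)) = F a)"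
proof -
  define s1 where "s1 = (\<lambda>(c::bit) (a::'v). if c = 1 then a else 0)"
  define s2 where "s2 = (\<lambda>(c::bit) (a::'w). if c = 1 then a else 0)"
  have s: "s1 (c + c') a = s1 c a + s1 c' a" "s1 (c * c') a = s1 c (s1 c' a)" 
     "s2 (c + c') b = s2 c b + s2 c' b" "s2 (c * c') b = s2 c (s2 c' b)" for c c' a b
    by (cases c; cases c'; simp add: s1_def s2_def v w)+
  interpret vs1: vector_space s1
    by standard (simp_all only: s, simp_all add: s1_def)
  interpret vs2: vector_space s2
    by standard (simp_all only: s, simp_all add: s2_def)
  interpret vector_space_pair s1 s2 ..
  have F0: "F 0 = 0"
    using F[of 0 0] by simp
  have "Vector_Spaces.linear s1 s2 F"
    by unfold_locales (auto simp: F s1_def s2_def F0)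
  moreover have "vs1.subspace V"
    by (rule vs1.subspaceI) (use V in \<open>auto simp: s1_def\<close>)
  ultimately obtain g where g: "range g \<subseteq> V" "Vector_Spaces.linear s2 s1 g" "\<forall>v\<in>F ` V. F (g v) = v"
    using linear_exists_right_inverse_on by blast
  have "g (a + b) = g a + g b" for a b
    using g(2) by (simp add: linear_iff_module_hom module_hom.add)
  then show ?thesis
    using g(1,3) by blast
qed

section \<open>Differential graded algebras in characteristic two\<close>

text \<open>The set \<open>K\<close> is the underlying space of the algebra. The laws are assumed for all elements of the
  type because operations on cochains ignore the values of a function outside the basis and return
  functions that vanish there; only elements of \<open>K\<close> are determined by their values on the basis, so
  only they can be compared with coboundaries. There is no grading: the identities used hold for
  inhomogeneous elements, and signs do not occur.\<close>

locale dg_algebra2 =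
  fixes m :: "'r::ab_group_add \<Rightarrow> 'r \<Rightarrow> 'r" (infixl \<open>\<cdot>\<close> 70)
    and d :: "'r \<Rightarrow> 'r" and K :: "'r set"
  assumes char2: "a + a = (0::'r)"
    and K_add [simp]: "a \<in> K \<Longrightarrow> b \<in> K \<Longrightarrow> a + b \<in> K"
    and K_m [simp]: "a \<cdot> b \<in> K"
    and K_d [simp]: "d a \<in> K"
    and distl: "(a + b) \<cdot> c = a \<cdot> c + b \<cdot> c"
    and distr: "a \<cdot> (b + c) = a \<cdot> b + a \<cdot> c"
    and assoc: "(a \<cdot> b) \<cdot> c = a \<cdot> (b \<cdot> c)"
    and d_add: "d (a + b) = d a + d b"
    and d_d: "d (d a) = 0"
    and leibniz: "d (a \<cdot> b) = d a \<cdot> b + a \<cdot> d b"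
begin

definition exact :: "'r \<Rightarrow> bool"
  where "exact a \<longleftrightarrow> (\<exists>e\<in>K. a = d e)"

definition lie :: "'r \<Rightarrow> 'r \<Rightarrow> 'r"
  where "lie a b = a \<cdot> b + b \<cdot> a"

text \<open>If \<open>u\<^sup>2 = d x\<close> and \<open>[u, z] = d c\<close>, then \<open>[x, z] + [u, c]\<close> is a cocycle, because
  \<open>[u\<^sup>2, z] = [u, [u, z]]\<close> in characteristic 2. When cohomology is commutative, other choices of \<open>x\<close>
  and \<open>c\<close> change it by commutators of cocycles only, so its class depends on the classes of \<open>u\<close> and
  \<open>z\<close>. The property says that cohomology is commutative and this secondary operation is zero.\<close>

definition square_bracket_trivial :: bool
  where "square_bracket_trivial \<longleftrightarrow>
    (\<forall>a\<in>K. \<forall>b\<in>K. d a = 0 \<longrightarrow> d b = 0 \<longrightarrow> exact (lie a b)) \<and>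
    (\<forall>u\<in>K. \<forall>z\<in>K. \<forall>x\<in>K. \<forall>c\<in>K. d u = 0 \<longrightarrow> d z = 0 \<longrightarrow> d x = u \<cdot> u \<longrightarrow> d c = lie u z \<longrightarrow> exact (lie x z + lie u c))"

lemma char2': "a + (a + b) = (b::'r)"
  by (simp add: char2 flip: add.assoc)

lemma mult_0 [simp]: "0 \<cdot> a = 0" "a \<cdot> 0 = 0"
  using distl[of 0 0 a] distr[of a 0 0] by simp_all

lemma d_0 [simp]: "d 0 = 0"
  using d_add[of 0 0] by simp

lemmas dg_simps = char2 char2' distl distr assoc d_add d_d leibniz add.assoc add.commute add.left_commute lie_def

lemma exact_add: "exact a \<Longrightarrow> exact b \<Longrightarrow> exact (a + b)"
  unfolding exact_def by (metis d_add K_add)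

lemma lie_K [simp]: "lie a b \<in> K"
  by (simp add: lie_def)

lemma exact_d: "a \<in> K \<Longrightarrow> exact (d a)"
  unfolding exact_def by blast

lemma lie_closed: "d a = 0 \<Longrightarrow> d b = 0 \<Longrightarrow> d (lie a b) = 0"
  by (simp add: dg_simps)

lemma bracket_cocycle:
  assumes "d u = 0" "d z = 0" "d x = u \<cdot> u" "d c = lie u z"
  shows "d (lie x z + lie u c) = 0"
  using assms by (simp add: dg_simps)

text \<open>Invariance of the secondary class. Replacing \<open>u'\<close> and \<open>z'\<close> by cohomologous cocycles is
  followed by explicit new choices \<open>x1\<close> and \<open>c1\<close>; the given \<open>x\<close> and \<open>c\<close> differ from these by
  cocycles, and for those commutativity of cohomology applies.\<close>

lemma bracket_change:
  assumes comm: "\<And>a b. a \<in> K \<Longrightarrow> b \<in> K \<Longrightarrow> d a = 0 \<Longrightarrow> d b = 0 \<Longrightarrow> exact (lie a b)"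
    and K: "u \<in> K" "z \<in> K" "x \<in> K" "c \<in> K" "x' \<in> K" "c' \<in> K"
    and 0: "d u = 0" "d z = 0" "d x = u \<cdot> u" "d c = lie u z"
    and 1: "d u' = 0" "d z' = 0" "d x' = u' \<cdot> u'" "d c' = lie u' z'"
    and u: "u = u' + d e" and z: "z = z' + d g"
    and ex: "exact (lie x' z' + lie u' c')"
  shows "exact (lie x z + lie u c)"
proof -
  define x1 where "x1 = x' + lie u' e + e \<cdot> d e"
  define c1 where "c1 = c' + lie u' g + lie e z' + lie e (d g)"
  have K1: "x1 \<in> K" "c1 \<in> K"
    by (simp_all add: x1_def c1_def K)
  have x1: "d x1 = u \<cdot> u"
    unfolding x1_def u by (simp add: dg_simps 1)
  have c1: "d c1 = lie u z"
    unfolding c1_def u z by (simp add: dg_simps 1)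
  have p: "exact (lie (x + x1) z)"
    by (rule comm) (simp_all add: d_add 0 x1 char2 K K1)
  have q: "exact (lie u (c + c1))"
    by (rule comm) (simp_all add: d_add 0 c1 char2 K K1)
  \<comment> \<open>\<open>E\<close> collects the terms of \<open>lie x1 z + lie u c1\<close>: \<open>lie x' g\<close> and \<open>lie e c'\<close> absorb the brackets
    with \<open>d g\<close> and \<open>d e\<close>, the Jacobi identity turns the double brackets into the boundary of
    \<open>lie e (lie u' g)\<close>, and the terms in which \<open>e\<close> occurs twice are the boundary of \<open>e \<cdot> e \<cdot> z + e \<cdot> z \<cdot> e\<close>.\<close>
  define E where "E = lie x' g + lie e c' + e \<cdot> e \<cdot> z + e \<cdot> z \<cdot> e + lie e (lie u' g)"
  have "E \<in> K"
    by (simp add: E_def)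
  have "lie x1 z + lie u c1 = (lie x' z' + lie u' c') + d E"
    unfolding x1_def c1_def E_def u z by (simp add: dg_simps 1)
  moreover have "lie x z + lie u c = lie (x + x1) z + lie u (c + c1) + (lie x1 z + lie u c1)"
    by (simp add: dg_simps)
  ultimately show ?thesis
    using p q ex \<open>E \<in> K\<close> by (metis exact_add exact_d)
qed

end

text \<open>The last two assumptions say that \<open>f\<close> is bijective on cohomology.\<close>

locale dg_quasi_iso2 = S: dg_algebra2 m d K + R: dg_algebra2 m' d' K'
  for m :: "'r::ab_group_add \<Rightarrow> 'r \<Rightarrow> 'r" (infixl \<open>\<cdot>\<close> 70) and d and K
    and m' :: "'s::ab_group_add \<Rightarrow> 's \<Rightarrow> 's" (infixl \<open>\<star>\<close> 70) and d' and K' +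
  fixes f :: "'r \<Rightarrow> 's"
  assumes f_add: "f (a + b) = f a + f b"
    and f_mult: "f (a \<cdot> b) = f a \<star> f b"
    and f_d: "f (d a) = d' (f a)"
    and f_K [simp]: "f a \<in> K'"
    and inj: "a \<in> K \<Longrightarrow> d a = 0 \<Longrightarrow> R.exact (f a) \<Longrightarrow> S.exact a"
    and surj: "y \<in> K' \<Longrightarrow> d' y = 0 \<Longrightarrow> \<exists>a\<in>K. \<exists>e\<in>K'. d a = 0 \<and> y = f a + d' e"
begin

lemma f_lie: "f (S.lie a b) = R.lie (f a) (f b)"
  by (simp add: S.lie_def R.lie_def f_add f_mult)

lemma f_0: "f 0 = 0"
  using f_add[of 0 0] by simp

lemma reflects:
  assumes "R.square_bracket_trivial"
  shows "S.square_bracket_trivial"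
  unfolding S.square_bracket_trivial_def
proof (intro conjI allI ballI impI)
  fix a b assume ab: "a \<in> K" "b \<in> K" "d a = 0" "d b = 0"
  then have "R.exact (f (S.lie a b))"
    using assms unfolding R.square_bracket_trivial_def f_lie by (metis f_0 f_d f_K)
  then show "S.exact (S.lie a b)"
    using inj S.lie_closed ab by simp
next
  fix u z x c assume a: "d u = 0" "d z = 0" "d x = u \<cdot> u" "d c = S.lie u z"
  then have "d' (f u) = 0" "d' (f z) = 0" "d' (f x) = f u \<star> f u" "d' (f c) = R.lie (f u) (f z)"
    by (metis f_0 f_d f_mult f_lie)+
  then have "R.exact (f (S.lie x z + S.lie u c))"
    using assms f_K unfolding R.square_bracket_trivial_def f_lie f_add by blast
  then show "S.exact (S.lie x z + S.lie u c)"
    using inj S.bracket_cocycle a by simp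
qed

text \<open>This is the direction that needs independence of choices: cocycles of the target are only
  cohomologous to images, and \<open>x\<close>, \<open>c\<close> in the target need not come from the source.\<close>

lemma preserves:
  assumes S: "S.square_bracket_trivial"
  shows "R.square_bracket_trivial"
proof -
  have comm: "R.exact (R.lie a b)" if ab: "a \<in> K'" "b \<in> K'" "d' a = 0" "d' b = 0" for a b
  proof -
    obtain a' e where a: "a' \<in> K" "d a' = 0" "a = f a' + d' e"
      using surj ab by metis
    obtain b' g where b: "b' \<in> K" "d b' = 0" "b = f b' + d' g"
      using surj ab by metis
    obtain h where h: "S.lie a' b' = d h"
      using S a b unfolding S.square_bracket_trivial_def S.exact_def by metis
    have fa: "d' (f a') = 0" "d' (f b') = 0"
      using a b by (metis f_0 f_d)+
    have "R.lie a b = R.lie (f a') (f b') + d' (R.lie e (f b') + R.lie (f a') g + R.lie e (d' g))"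
      unfolding a b by (simp add: R.dg_simps fa)
    also have "R.lie (f a') (f b') = d' (f h)"
      by (metis f_lie f_d h)
    finally show ?thesis
      by (simp add: R.exact_add R.exact_d)
  qed
  have "R.exact (R.lie x z + R.lie u c)"
    if K: "u \<in> K'" "z \<in> K'" "x \<in> K'" "c \<in> K'"
      and a: "d' u = 0" "d' z = 0" "d' x = u \<star> u" "d' c = R.lie u z" for u z x c
  proof -
    obtain u' e where u': "u' \<in> K" "d u' = 0" "u = f u' + d' e"
      using surj K a by metis
    obtain z' g where z': "z' \<in> K" "d z' = 0" "z = f z' + d' g"
      using surj K a by metis
    have fu: "d' (f u') = 0" "d' (f z') = 0"
      using u' z' by (metis f_0 f_d)+
    have "f (u' \<cdot> u') = d' (x + R.lie (f u') e + e \<star> d' e)"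
      unfolding R.d_add a(3) unfolding u'(3) by (simp add: R.dg_simps fu f_mult)
    then have "R.exact (f (u' \<cdot> u'))"
      using R.exact_d K by simp
    then obtain x' where x': "x' \<in> K" "u' \<cdot> u' = d x'"
      using inj[of "u' \<cdot> u'"] u' by (auto simp: S.leibniz S.exact_def)
    obtain c' where c': "c' \<in> K" "S.lie u' z' = d c'"
      using S u' z' unfolding S.square_bracket_trivial_def S.exact_def by metis
    have "S.exact (S.lie x' z' + S.lie u' c')"
      using S u' z' x' c' unfolding S.square_bracket_trivial_def by metis
    then have "R.exact (R.lie (f x') (f z') + R.lie (f u') (f c'))"
      unfolding S.exact_def R.exact_def by (metis f_add f_lie f_d f_K)
    moreover have "d' (f x') = f u' \<star> f u'" "d' (f c') = R.lie (f u') (f z')"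
      by (metis f_d f_mult x'(2)) (metis f_d f_lie c'(2))
    ultimately show ?thesis
      using R.bracket_change[OF comm K f_K f_K a fu _ _ u'(3) z'(3)] by blast
  qed
  with comm show ?thesis
    unfolding R.square_bracket_trivial_def by blast
qed

end

section \<open>The dual algebra of a chain coalgebra\<close>

text \<open>Cochains are all functions on the basis, the product of the duals of the homogeneous parts. They are
  set to zero outside the basis, so that the associative and Leibniz laws hold as equations between
  functions.\<close>

definition cup :: "'b chain_coalg \<Rightarrow> ('b \<Rightarrow> bit) \<Rightarrow> ('b \<Rightarrow> bit) \<Rightarrow> 'b \<Rightarrow> bit"
  where "cup C \<phi> \<psi> = (\<lambda>b. if b \<in> basis C then ev (outer \<phi> \<psi>) (comult C b) else 0)"

definition cobdry :: "'b chain_coalg \<Rightarrow> ('b \<Rightarrow> bit) \<Rightarrow> 'b \<Rightarrow> bit"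
  where "cobdry C \<phi> = (\<lambda>b. if b \<in> basis C then ev \<phi> (bdry C b) else 0)"

definition cochains :: "'b chain_coalg \<Rightarrow> ('b \<Rightarrow> bit) set"
  where "cochains C = {\<phi>. \<forall>b. b \<notin> basis C \<longrightarrow> \<phi> b = 0}"

abbreviation total_chains :: "'b chain_coalg \<Rightarrow> ('b \<Rightarrow>\<^sub>0 bit) set"
  where "total_chains C \<equiv> {x. Poly_Mapping.keys x \<subseteq> basis C}"

lemma ev_cobdry: "x \<in> total_chains C \<Longrightarrow> ev (cobdry C \<phi>) x = ev \<phi> (lin (bdry C) x)"
  unfolding ev_lin by (rule ev_cong[of _ "basis C"]) (auto simp: cobdry_def)

lemma ev_cup: "x \<in> total_chains C \<Longrightarrow> ev (cup C \<phi> \<psi>) x = ev (outer \<phi> \<psi>) (lin (comult C) x)"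
  unfolding ev_lin by (rule ev_cong[of _ "basis C"]) (auto simp: cup_def)

lemma outer_cong: "Poly_Mapping.keys x \<subseteq> A \<times> B \<Longrightarrow> (\<And>b. b \<in> A \<Longrightarrow> \<phi> b = \<phi>' b) \<Longrightarrow> (\<And>b. b \<in> B \<Longrightarrow> \<psi> b = \<psi>' b)
    \<Longrightarrow> ev (outer \<phi> \<psi>) x = ev (outer \<phi>' \<psi>') x"
  by (rule ev_cong[of _ "A \<times> B"]) (auto simp: outer_def)

lemma
  assumes "chain_coalgebra C" "b \<in> basis C"
  shows keys_bdry: "Poly_Mapping.keys (bdry C b) \<subseteq> {c \<in> basis C. Suc (deg C c) = deg C b}"
    and keys_comult': "Poly_Mapping.keys (comult C b)
         \<subseteq> {(c, d). c \<in> basis C \<and> d \<in> basis C \<and> deg C c + deg C d = deg C b}"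
    and bdry_bdry_basis: "lin (bdry C) (bdry C b) = 0"
    and comult_bdry: "lin (comult C) (bdry C b)
         = tensor_map (bdry C) gen (comult C b) + tensor_map gen (bdry C) (comult C b)"
    and coassoc: "tensor_assoc (tensor_map (comult C) gen (comult C b))
         = tensor_map gen (comult C) (comult C b)"
  using assms by (simp_all add: chain_coalgebra_def)

context
  fixes C :: "'b chain_coalg"
  assumes C: "chain_coalgebra C"
begin

lemma bdry_total: "b \<in> basis C \<Longrightarrow> bdry C b \<in> total_chains C"
  using keys_bdry[OF C] by fast

lemma lin_bdry_total: "x \<in> total_chains C \<Longrightarrow> lin (bdry C) x \<in> total_chains C"
  unfolding mem_Collect_eq by (erule keys_lin) (use bdry_total in simp)

lemma keys_comult: "b \<in> basis C \<Longrightarrow> Poly_Mapping.keys (comult C b) \<subseteq> basis C \<times> basis C"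
  using keys_comult'[OF C] by fast

lemma bdry_bdry: "x \<in> total_chains C \<Longrightarrow> lin (bdry C) (lin (bdry C) x) = 0"
  unfolding mem_Collect_eq
  by (induction rule: F2_induct) (simp_all add: bdry_bdry_basis[OF C])

lemma dg_algebra2_cochains: "dg_algebra2 (cup C) (cobdry C) (cochains C)"
proof
  fix \<phi> \<psi> \<omega> :: "'b \<Rightarrow> bit"
  show "\<phi> + \<phi> = 0"
    by (simp add: fun_eq_iff)
  show "\<phi> \<in> cochains C \<Longrightarrow> \<psi> \<in> cochains C \<Longrightarrow> \<phi> + \<psi> \<in> cochains C"
    by (simp add: cochains_def)
  show "cup C \<phi> \<psi> \<in> cochains C" "cobdry C \<phi> \<in> cochains C"
    by (simp_all add: cochains_def cup_def cobdry_def)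
  have "outer (\<phi> + \<psi>) \<omega> = outer \<phi> \<omega> + outer \<psi> \<omega>"
    "outer \<phi> (\<psi> + \<omega>) = outer \<phi> \<psi> + outer \<phi> \<omega>"
    by (auto simp: outer_def algebra_simps fun_eq_iff)
  then show "cup C (\<phi> + \<psi>) \<omega> = cup C \<phi> \<omega> + cup C \<psi> \<omega>"
    "cup C \<phi> (\<psi> + \<omega>) = cup C \<phi> \<psi> + cup C \<phi> \<omega>"
    unfolding cup_def by (simp_all only: ev_plus) (simp_all add: fun_eq_iff)
  show "cobdry C (\<phi> + \<psi>) = cobdry C \<phi> + cobdry C \<psi>"
    unfolding cobdry_def ev_plus by (simp add: fun_eq_iff)
  show "cobdry C (cobdry C \<phi>) = 0"
    using bdry_bdry[of "gen b" for b] bdry_total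
    by (auto simp: fun_eq_iff cobdry_def[of C "cobdry C \<phi>"] ev_cobdry)
  show "cup C (cup C \<phi> \<psi>) \<omega> = cup C \<phi> (cup C \<psi> \<omega>)"
  proof
    fix b show "cup C (cup C \<phi> \<psi>) \<omega> b = cup C \<phi> (cup C \<psi> \<omega>) b"
    proof (cases "b \<in> basis C")
      case True
      let ?e = "\<lambda>\<phi> \<psi> b. ev (outer \<phi> \<psi>) (comult C b)"
      have "cup C (cup C \<phi> \<psi>) \<omega> b = ev (outer (\<lambda>b. ?e \<phi> \<psi> b) (\<lambda>b. ev \<omega> (gen b))) (comult C b)"
        unfolding cup_def[of C "cup C \<phi> \<psi>"] if_P[OF True]
        by (rule outer_cong[OF keys_comult[OF True]]) (simp_all add: cup_def)
      also have "\<dots> = ev (outer (outer \<phi> \<psi>) \<omega>) (tensor_map (comult C) gen (comult C b))"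
        by (simp only: ev_tensor_map)
      also have "\<dots> = ev (outer \<phi> (outer \<psi> \<omega>)) (tensor_map gen (comult C) (comult C b))"
        by (simp only: coassoc[OF C True, symmetric] ev_tensor_assoc)
      also have "\<dots> = ev (outer (\<lambda>b. ev \<phi> (gen b)) (\<lambda>b. ?e \<psi> \<omega> b)) (comult C b)"
        by (simp only: ev_tensor_map)
      also have "\<dots> = cup C \<phi> (cup C \<psi> \<omega>) b"
        unfolding cup_def[of C \<phi> "cup C \<psi> \<omega>"] if_P[OF True]
        by (rule outer_cong[OF keys_comult[OF True]]) (simp_all add: cup_def)
      finally show ?thesis .
    qed (simp add: cup_def)
  qed
  show "cobdry C (cup C \<phi> \<psi>) = cup C (cobdry C \<phi>) \<psi> + cup C \<phi> (cobdry C \<psi>)"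
  proof
    fix b show "cobdry C (cup C \<phi> \<psi>) b = (cup C (cobdry C \<phi>) \<psi> + cup C \<phi> (cobdry C \<psi>)) b"
    proof (cases "b \<in> basis C")
      case True
      have "cobdry C (cup C \<phi> \<psi>) b = ev (outer \<phi> \<psi>) (lin (comult C) (bdry C b))"
        using True bdry_total by (simp add: cobdry_def ev_cup)
      also have "\<dots> = ev (outer \<phi> \<psi>) (tensor_map (bdry C) gen (comult C b))
          + ev (outer \<phi> \<psi>) (tensor_map gen (bdry C) (comult C b))"
        by (simp add: comult_bdry[OF C True])
      also have "\<dots> = ev (outer (cobdry C \<phi>) \<psi>) (comult C b) + ev (outer \<phi> (cobdry C \<psi>)) (comult C b)"
        unfolding ev_tensor_map using keys_comult[OF True]
        by (intro arg_cong2[of _ _ _ _ "(+)"] outer_cong) (auto simp: cobdry_def)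
      finally show ?thesis
        using True by (simp add: cup_def)
    qed (simp_all add: cup_def cobdry_def)
  qed
qed

end

subsection \<open>Homogeneous components\<close>

definition part :: "'b chain_coalg \<Rightarrow> nat \<Rightarrow> ('b \<Rightarrow>\<^sub>0 bit) \<Rightarrow> ('b \<Rightarrow>\<^sub>0 bit)"
  where "part C n = lin (\<lambda>b. if deg C b = n then gen b else 0)"

lemma part_add: "part C n (x + y) = part C n x + part C n y"
  by (simp add: part_def)

lemma part_chains: "x \<in> total_chains C \<Longrightarrow> part C n x \<in> chains C n"
  unfolding part_def chains_def mem_Collect_eq
  by (rule keys_lin[of _ "basis C"]) auto

lemma chains_total: "x \<in> chains C n \<Longrightarrow> x \<in> total_chains C"
  by (auto simp: chains_def)

lemma part_same: "x \<in> chains C n \<Longrightarrow> part C k x = (if k = n then x else 0)"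
  unfolding chains_def mem_Collect_eq
  by (induction rule: F2_induct) (auto simp: part_def)

lemma chains_add: "x \<in> chains C n \<Longrightarrow> y \<in> chains C n \<Longrightarrow> x + y \<in> chains C n"
  by (simp add: chains_def keys_add_subset)

lemma chains_0: "0 \<in> chains C n"
  by (simp add: chains_def)

lemma sum_part: "x = (\<Sum>n\<in>deg C ` Poly_Mapping.keys x. part C n x)"
proof -
  have "x = (\<Sum>n\<in>N. part C n x)" if N: "finite N" "deg C ` Poly_Mapping.keys x \<subseteq> N" for N
    using N(2) unfolding image_subset_iff_subset_vimage
  proof (induction rule: F2_induct[of _ "deg C -` N"])
    case (add y z)
    then show ?case
      by (simp add: part_add sum.distrib)
  next
    case (gen b)
    then show ?case
      using N(1) by (simp add: part_def)
  qed (simp_all add: part_def)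
  then show ?thesis
    using finite_imageI[OF finite_keys] order_refl by metis
qed

lemma total_sum: "(\<And>i. i \<in> I \<Longrightarrow> x i \<in> total_chains C) \<Longrightarrow> sum x I \<in> total_chains C"
  by (simp add: keys_sum_subset)

lemma lin_bdry_chains:
  assumes C: "chain_coalgebra C" and x: "x \<in> chains C (Suc n)"
  shows "lin (bdry C) x \<in> chains C n"
  using x unfolding chains_def mem_Collect_eq
  by (rule keys_lin) (use keys_bdry[OF C] in fastforce)

lemma part_bdry:
  assumes C: "chain_coalgebra C" and x: "x \<in> total_chains C"
  shows "part C n (lin (bdry C) x) = lin (bdry C) (part C (Suc n) x)"
  using x unfolding mem_Collect_eq
proof (induction rule: F2_induct)
  case (gen b)
  then show ?case
  proof (cases "deg C b")
    case 0
    then have "bdry C b = 0"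
      using keys_bdry[OF C gen] by auto
    then show ?thesis
      using 0 by (simp add: part_def)
  next
    case (Suc k)
    then have "bdry C b \<in> chains C k"
      using lin_bdry_chains[OF C, of "gen b" k] gen by (simp add: chains_def)
    then show ?thesis
      using Suc by (auto simp: part_same) (simp_all add: part_def)
  qed
qed (simp_all add: part_def)

lemma bdry_part_cycle:
  assumes C: "chain_coalgebra C" and x: "x \<in> total_chains C" "lin (bdry C) x = 0"
  shows "part C n x \<in> cycles C n"
proof (cases n)
  case 0
  have "bdry C b = 0" if "b \<in> basis C" "deg C b = 0" for b
    using keys_bdry[OF C that(1)] that(2) by auto
  then have "lin (bdry C) (part C 0 x) = lin (\<lambda>b. 0) (part C 0 x)"
    unfolding lin_ev using part_chains[OF x(1), of 0]
    by (intro ev_cong[of _ "{b \<in> basis C. deg C b = 0}"]) (auto simp: chains_def)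
  then show ?thesis
    using 0 part_chains[OF x(1)] by (simp add: cycles_def lin_def)
next
  case (Suc k)
  then show ?thesis
    using part_chains[OF x(1)] part_bdry[OF C x(1), of k] x(2) by (simp add: cycles_def part_def)
qed

subsection \<open>Cocycles and functionals\<close>

lemma additive_ev:
  assumes "\<And>a b. h (a + b) = h a + (h b :: bit)"
  shows "ev (\<lambda>b. h (gen b)) x = h x"
proof -
  have "h 0 = 0"
    using assms[of 0 0] by simp
  then show ?thesis
    by (induction rule: F2_induct[OF subset_UNIV, of _ x]) (simp_all add: assms)
qed

text \<open>A functional that kills all cycles factors through the differential, and the factor extends from
  the boundaries to all chains by means of a section of the differential.\<close>

lemma exact_if_vanishes_on_cycles:
  assumes E: "chain_coalgebra E" and \<phi>: "\<phi> \<in> cochains E"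
    and van: "\<And>z. z \<in> total_chains E \<Longrightarrow> lin (bdry E) z = 0 \<Longrightarrow> ev \<phi> z = 0"
  shows "\<exists>\<eta>\<in>cochains E. \<phi> = cobdry E \<eta>"
proof -
  have "\<exists>g. (\<forall>a b. g (a + b) = g a + g b) \<and> (\<forall>a. g a \<in> total_chains E) \<and>
      (\<forall>a\<in>total_chains E. lin (bdry E) (g (lin (bdry E) a)) = lin (bdry E) a)"
    by (rule additive_section[where V = "total_chains E" and F = "lin (bdry E)"])
      (simp_all add: keys_add_subset)
  then obtain g where g: "\<And>a b. g (a + b) = g a + g b" "\<And>a. g a \<in> total_chains E"
    "\<And>a. a \<in> total_chains E \<Longrightarrow> lin (bdry E) (g (lin (bdry E) a)) = lin (bdry E) a"
    by blast
  define \<eta> where "\<eta> = (\<lambda>b. if b \<in> basis E then ev \<phi> (g (gen b)) else 0)"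
  have "\<phi> b = cobdry E \<eta> b" if b: "b \<in> basis E" for b
  proof -
    have "ev \<phi> (gen b + g (bdry E b)) = 0"
    proof (rule van)
      show "gen b + g (bdry E b) \<in> total_chains E"
        using b g(2) by (simp add: keys_add_subset)
      show "lin (bdry E) (gen b + g (bdry E b)) = 0"
        using b g(3)[of "gen b"] by simp
    qed
    then have "\<phi> b = ev \<phi> (g (bdry E b))"
      by (cases "\<phi> b"; cases "ev \<phi> (g (bdry E b))") simp_all
    also have "\<dots> = ev (\<lambda>b. ev \<phi> (g (gen b))) (bdry E b)"
      by (rule additive_ev[symmetric]) (simp add: g(1))
    also have "\<dots> = ev \<eta> (bdry E b)"
      by (rule ev_cong[of _ "basis E"]) (use bdry_total[OF E b] in \<open>auto simp: \<eta>_def\<close>)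
    finally show ?thesis
      using b by (simp add: cobdry_def)
  qed
  moreover have "\<eta> \<in> cochains E"
    by (simp add: \<eta>_def cochains_def)
  ultimately show ?thesis
    using \<phi> by (intro bexI[of _ \<eta>]) (auto simp: cochains_def cobdry_def fun_eq_iff)
qed

lemma ev_cocycle:
  assumes "cobdry E \<phi> = 0" "x \<in> total_chains E"
  shows "ev \<phi> (lin (bdry E) x) = 0"
  using ev_cobdry[OF assms(2), of \<phi>] assms(1) by (simp add: ev_def)

subsection \<open>Quasi-isomorphisms on total chains\<close>

locale coalg_quasi_iso_map =
  fixes C :: "'b chain_coalg" and D :: "'c chain_coalg" and f
  assumes C: "chain_coalgebra C" and D: "chain_coalgebra D"
    and hom: "coalg_hom C D f"
    and bij: "bij_betw (homology_map D f n) (homology C n) (homology D n)"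
begin

lemma f_keys: "b \<in> basis C \<Longrightarrow> f b \<in> total_chains D"
  using hom by (fastforce simp: coalg_hom_def chains_def)

lemma f_chains: "x \<in> chains C n \<Longrightarrow> lin f x \<in> chains D n"
  unfolding chains_def mem_Collect_eq
  by (erule keys_lin) (use hom in \<open>fastforce simp: coalg_hom_def chains_def\<close>)

lemma f_total: "x \<in> total_chains C \<Longrightarrow> lin f x \<in> total_chains D"
  unfolding mem_Collect_eq by (erule keys_lin) (use f_keys in simp)

lemma f_bdry: "x \<in> total_chains C \<Longrightarrow> lin f (lin (bdry C) x) = lin (bdry D) (lin f x)"
  unfolding mem_Collect_eq
  by (induction rule: F2_induct) (use hom in \<open>simp_all add: coalg_hom_def\<close>)

lemma part_f: "x \<in> total_chains C \<Longrightarrow> part D n (lin f x) = lin f (part C n x)"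
  unfolding mem_Collect_eq
proof (induction rule: F2_induct)
  case (gen b)
  then have "f b \<in> chains D (deg C b)"
    using hom by (simp add: coalg_hom_def)
  then show ?case
    by (auto simp: part_same) (simp_all add: part_def)
qed (simp_all add: part_def)

text \<open>Since homology classes are sets, the image under the homology map is the union of classes
  of all \<open>lin f z\<close> with \<open>z\<close> in the class. So \<open>y\<close>, as a member of its own class, is homologous to
  some \<open>lin f z\<close>.\<close>

lemma homology_surj:
  assumes y: "y \<in> cycles D n"
  obtains z w where "z \<in> cycles C n" "w \<in> chains D (Suc n)" "y = lin f z + lin (bdry D) w"
proof -
  have "homologous D n `` {y} \<in> homology D n"
    using y by (auto simp: homology_def quotient_def)
  then obtain h where h: "h \<in> homology C n" "homologous D n `` {y} = homologous D n `` (lin f ` h)"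
    using bij[of n] by (metis (no_types, lifting) bij_betw_imp_surj_on homology_map_def imageE)
  obtain z0 where z0: "h = homologous C n `` {z0}"
    using h(1) by (auto simp: homology_def quotient_def)
  have "0 \<in> boundaries D n"
    unfolding boundaries_def using chains_0 by (metis image_eqI lin_0)
  then have "(y, y) \<in> homologous D n"
    using y by (simp add: homologous_def)
  then obtain z where z: "(z0, z) \<in> homologous C n" "(lin f z, y) \<in> homologous D n"
    using h(2) z0 by blast
  then obtain w where "w \<in> chains D (Suc n)" "lin f z + y = lin (bdry D) w"
    by (auto simp: homologous_def boundaries_def poly_minus)
  moreover have "z \<in> cycles C n"
    using z(1) by (simp add: homologous_def)
  moreover have "y = lin f z + (lin f z + y)"
    by simp
  ultimately show ?thesis
    using that by metis
qed

text \<open>Classes of cycles that \<open>f\<close> sends to boundaries all have the set of bounding cycles as image, in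
  particular the class of 0.\<close>

lemma homology_inj:
  assumes z: "z \<in> cycles C n" and w: "w \<in> chains D (Suc n)" "lin f z = lin (bdry D) w"
  obtains v where "v \<in> chains C (Suc n)" "z = lin (bdry C) v"
proof -
  have bd_add: "x + y \<in> boundaries D n" if "x \<in> boundaries D n" "y \<in> boundaries D n" for x y
    using that unfolding boundaries_def by (auto simp flip: lin_add intro: chains_add)
  have f_bd: "lin f x \<in> boundaries D n" if "x \<in> boundaries C n" for x
    using that unfolding boundaries_def using f_chains f_bdry[OF chains_total] by blast
  have f_cyc: "lin f x \<in> cycles D n" if "x \<in> cycles C n" for x
    using that f_chains f_bdry[OF chains_total, of x n] by (auto simp: cycles_def)
  have 0: "0 \<in> boundaries D n" "0 \<in> boundaries C n" "0 \<in> cycles C n"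
    unfolding boundaries_def cycles_def using chains_0 by (force intro: image_eqI[of _ _ 0])+
  have *: "homology_map D f n (homologous C n `` {x}) = cycles D n \<inter> boundaries D n"
    if x: "x \<in> cycles C n" "lin f x \<in> boundaries D n" for x
  proof -
    have bd: "lin f x' \<in> boundaries D n" if "(x, x') \<in> homologous C n" for x'
    proof -
      have "lin f (x - x') \<in> boundaries D n"
        using that f_bd by (simp add: homologous_def)
      then have "lin f x + lin f x' \<in> boundaries D n"
        by (simp add: poly_minus)
      then show ?thesis
        using bd_add[OF x(2)] by fastforce
    qed
    show ?thesis
    proof (intro equalityI subsetI)
      fix y assume "y \<in> homology_map D f n (homologous C n `` {x})"
      then obtain x' where x': "(x, x') \<in> homologous C n" "(lin f x', y) \<in> homologous D n"
        by (auto simp: homology_map_def)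
      then have "lin f x' + y \<in> boundaries D n" "y \<in> cycles D n"
        by (simp_all add: homologous_def poly_minus)
      then show "y \<in> cycles D n \<inter> boundaries D n"
        using bd_add[OF bd[OF x'(1)]] by fastforce
    next
      fix y assume "y \<in> cycles D n \<inter> boundaries D n"
      then have "(lin f x, y) \<in> homologous D n"
        using x f_cyc bd_add by (simp add: homologous_def poly_minus)
      moreover have "(x, x) \<in> homologous C n"
        using x 0 by (simp add: homologous_def)
      ultimately show "y \<in> homology_map D f n (homologous C n `` {x})"
        by (auto simp: homology_map_def)
    qed
  qed
  have "lin f z \<in> boundaries D n"
    using w by (auto simp: boundaries_def)
  then have "homology_map D f n (homologous C n `` {z}) = homology_map D f n (homologous C n `` {0})"
    using * z 0 by simp
  moreover have "homologous C n `` {z} \<in> homology C n" "homologous C n `` {0} \<in> homology C n"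
    using z 0 by (auto simp: homology_def quotient_def)
  ultimately have "homologous C n `` {z} = homologous C n `` {0}"
    using bij[of n] by (meson bij_betw_imp_inj_on inj_onD)
  moreover have "(z, z) \<in> homologous C n"
    using z 0 by (simp add: homologous_def)
  ultimately have "(0, z) \<in> homologous C n"
    by blast
  then show ?thesis
    using that by (auto simp: homologous_def boundaries_def poly_minus)
qed

text \<open>A quasi-isomorphism in each degree is one on inhomogeneous chains: a cycle and its bounding
  chains split into homogeneous components.\<close>

lemma total_surj:
  assumes y: "y \<in> total_chains D" "lin (bdry D) y = 0"
  obtains z w where "z \<in> total_chains C" "lin (bdry C) z = 0" "w \<in> total_chains D"
    "y = lin f z + lin (bdry D) w"
proof -
  have "\<exists>z w. z \<in> total_chains C \<and> lin (bdry C) z = 0 \<and> w \<in> total_chains D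
      \<and> part D n y = lin f z + lin (bdry D) w" for n
    using homology_surj[OF bdry_part_cycle[OF D y], of n]
    by (metis (mono_tags, lifting) chains_total cycles_def mem_Collect_eq)
  then obtain z w where zw: "\<And>n. z n \<in> total_chains C" "\<And>n. lin (bdry C) (z n) = 0" "\<And>n. w n \<in> total_chains D"
      "\<And>n. part D n y = lin f (z n) + lin (bdry D) (w n)"
    by metis
  let ?N = "deg D ` Poly_Mapping.keys y"
  show ?thesis
  proof
    show "(\<Sum>n\<in>?N. z n) \<in> total_chains C" "(\<Sum>n\<in>?N. w n) \<in> total_chains D"
      by (rule total_sum, rule zw)+
    show "lin (bdry C) (\<Sum>n\<in>?N. z n) = 0"
      by (simp add: lin_sum zw)
    show "y = lin f (\<Sum>n\<in>?N. z n) + lin (bdry D) (\<Sum>n\<in>?N. w n)"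
      by (subst sum_part[of y D]) (simp add: lin_sum zw sum.distrib)
  qed
qed

lemma total_inj:
  assumes z: "z \<in> total_chains C" "lin (bdry C) z = 0"
    and w: "w \<in> total_chains D" "lin f z = lin (bdry D) w"
  obtains v where "v \<in> total_chains C" "z = lin (bdry C) v"
proof -
  have "\<exists>v. v \<in> total_chains C \<and> part C n z = lin (bdry C) v" for n
  proof -
    have "lin f (part C n z) = lin (bdry D) (part D (Suc n) w)"
      using part_f part_bdry[OF D] z w by metis
    then show ?thesis
      using homology_inj[OF bdry_part_cycle[OF C z] part_chains[OF w(1)]] chains_total by metis
  qed
  then obtain v where "\<And>n. v n \<in> total_chains C" "\<And>n. part C n z = lin (bdry C) (v n)"
    by metis
  moreover from this have "z = lin (bdry C) (\<Sum>n\<in>deg C ` Poly_Mapping.keys z. v n)"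
    by (subst sum_part[of z C]) (simp add: lin_sum)
  ultimately show ?thesis
    using that total_sum by metis
qed

subsection \<open>The dual map\<close>

definition dual :: "('c \<Rightarrow> bit) \<Rightarrow> 'b \<Rightarrow> bit"
  where "dual \<phi> = (\<lambda>b. if b \<in> basis C then ev \<phi> (f b) else 0)"

lemma ev_dual: "x \<in> total_chains C \<Longrightarrow> ev (dual \<phi>) x = ev \<phi> (lin f x)"
  unfolding ev_lin by (rule ev_cong[of _ "basis C"]) (auto simp: dual_def)

lemma dual_inj:
  assumes \<phi>: "\<phi> \<in> cochains D" "cobdry D \<phi> = 0" and \<eta>: "dual \<phi> = cobdry C \<eta>"
  shows "\<exists>\<zeta>\<in>cochains D. \<phi> = cobdry D \<zeta>"
proof (rule exact_if_vanishes_on_cycles[OF D \<phi>(1)])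
  fix y assume "y \<in> total_chains D" "lin (bdry D) y = 0"
  then obtain z w where z: "z \<in> total_chains C" "lin (bdry C) z = 0" and w: "w \<in> total_chains D"
    and y: "y = lin f z + lin (bdry D) w"
    using total_surj by metis
  have "ev \<phi> (lin f z) = ev (cobdry C \<eta>) z"
    using ev_dual z \<eta> by metis
  also have "\<dots> = 0"
    using ev_cobdry[OF z(1)] z by simp
  finally show "ev \<phi> y = 0"
    using ev_cocycle[OF \<phi>(2) w] y by simp
qed

text \<open>A cocycle on the source is a functional on homology, hence on the homology of the target. To
  represent that by a functional on all chains, split the map \<open>(z, w) \<mapsto> f z + \<partial> w\<close> from cycles
  and chains onto the cycles of the target, and evaluate \<open>\<phi>\<close> on the first component of the section.
  On cycles of the source it agrees with \<open>\<phi>\<close>, so the difference is a coboundary.\<close>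

lemma dual_surj:
  assumes \<phi>: "\<phi> \<in> cochains C" "cobdry C \<phi> = 0"
  obtains \<psi> \<eta> where "\<psi> \<in> cochains D" "\<eta> \<in> cochains C" "cobdry D \<psi> = 0" "\<phi> = dual \<psi> + cobdry C \<eta>"
proof -
  define V where "V = {(z, w). z \<in> total_chains C \<and> lin (bdry C) z = 0 \<and> w \<in> total_chains D}"
  define F where "F = (\<lambda>(z, w). lin f z + lin (bdry D) w)"
  have van: "ev \<phi> z = 0" if "z \<in> total_chains C" "lin (bdry C) z = 0" "w \<in> total_chains D" "lin f z = lin (bdry D) w" for z w
    using total_inj[OF that] ev_cocycle[OF \<phi>(2)] by metis
  have "\<exists>g. (\<forall>a b. g (a + b) = g a + g b) \<and> (\<forall>a. g a \<in> V) \<and> (\<forall>a\<in>V. F (g (F a)) = F a)"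
  proof (rule additive_section[where V = V and F = F])
    show "a + a = 0" for a :: "('b \<Rightarrow>\<^sub>0 bit) \<times> ('c \<Rightarrow>\<^sub>0 bit)"
      by (cases a) (simp add: zero_prod_def)
    show "0 \<in> V"
      by (simp add: V_def zero_prod_def)
    show "a + b \<in> V" if "a \<in> V" "b \<in> V" for a b
      using that by (simp add: V_def case_prod_unfold keys_add_subset)
    show "F (a + b) = F a + F b" for a b
      by (simp add: F_def case_prod_unfold ac_simps)
  qed (rule poly_double)
  then obtain g where g: "\<And>a b. g (a + b) = g a + g b" "\<And>a. g a \<in> V"
    "\<And>a. a \<in> V \<Longrightarrow> F (g (F a)) = F a"
    by blast
  define \<psi> where "\<psi> = (\<lambda>b. if b \<in> basis D then ev \<phi> (fst (g (gen b))) else 0)"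
  have \<psi>: "ev \<psi> y = ev \<phi> (fst (g y))" if "y \<in> total_chains D" for y
  proof -
    have "ev \<psi> y = ev (\<lambda>b. ev \<phi> (fst (g (gen b)))) y"
      by (rule ev_cong[of _ "basis D"]) (use that in \<open>auto simp: \<psi>_def\<close>)
    also have "\<dots> = ev \<phi> (fst (g y))"
      by (rule additive_ev) (simp add: g(1))
    finally show ?thesis .
  qed
  have key: "ev \<psi> (lin f z + lin (bdry D) w) = ev \<phi> z" if zw: "(z, w) \<in> V" for z w
  proof -
    obtain z' w' where g': "g (lin f z + lin (bdry D) w) = (z', w')"
      by fastforce
    have V': "(z', w') \<in> V"
      using g(2) g' by metis
    have "lin f z' + lin (bdry D) w' = lin f z + lin (bdry D) w"
      using g(3)[OF zw] g' by (simp add: F_def)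
    then have "lin f z' + lin (bdry D) w' + lin (bdry D) w' = lin f z + lin (bdry D) w + lin (bdry D) w'"
      by simp
    then have "lin f z' = lin f z + (lin (bdry D) w + lin (bdry D) w')"
      by (simp add: add.assoc)
    then have "lin f (z + z') = lin (bdry D) (w + w')"
      by simp
    then have "ev \<phi> (z + z') = 0"
      using van[of "z + z'" "w + w'"] V' zw by (simp add: V_def keys_add_subset)
    then have "ev \<phi> z' = ev \<phi> z"
      by (cases "ev \<phi> z"; cases "ev \<phi> z'") simp_all
    moreover have "lin f z + lin (bdry D) w \<in> total_chains D"
      using zw f_total lin_bdry_total[OF D] by (simp add: V_def keys_add_subset)
    ultimately show ?thesis
      using \<psi>[of "lin f z + lin (bdry D) w"] unfolding g' fst_conv by metis
  qed
  have coc: "cobdry D \<psi> = 0"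
  proof
    fix b
    show "cobdry D \<psi> b = 0 b"
      using key[of 0 "gen b"] by (auto simp: V_def cobdry_def)
  qed
  have dual_K: "dual \<psi> \<in> cochains C"
    by (simp add: dual_def cochains_def)
  have "\<exists>\<eta>\<in>cochains C. \<phi> + dual \<psi> = cobdry C \<eta>"
  proof (rule exact_if_vanishes_on_cycles[OF C])
    show "\<phi> + dual \<psi> \<in> cochains C"
      using \<phi>(1) dual_K by (simp add: cochains_def)
    show "ev (\<phi> + dual \<psi>) z = 0" if "z \<in> total_chains C" "lin (bdry C) z = 0" for z
      using key[of z 0] that ev_dual[OF that(1)] by (simp add: V_def ev_plus)
  qed
  then obtain \<eta> where \<eta>: "\<eta> \<in> cochains C" "\<phi> + dual \<psi> = cobdry C \<eta>" ..
  have "\<phi> = dual \<psi> + cobdry C \<eta>"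
    unfolding \<eta>(2)[symmetric] by (simp add: fun_eq_iff ac_simps)
  moreover have "\<psi> \<in> cochains D"
    by (simp add: \<psi>_def cochains_def)
  ultimately show ?thesis
    using that \<eta> coc by blast
qed

lemma dg_quasi_iso2_dual:
  "dg_quasi_iso2 (cup D) (cobdry D) (cochains D) (cup C) (cobdry C) (cochains C) dual"
proof -
  interpret S: dg_algebra2 "cup D" "cobdry D" "cochains D"
    by (rule dg_algebra2_cochains[OF D])
  interpret R: dg_algebra2 "cup C" "cobdry C" "cochains C"
    by (rule dg_algebra2_cochains[OF C])
  show ?thesis
  proof
    fix \<phi> \<psi>
    show "dual (\<phi> + \<psi>) = dual \<phi> + dual \<psi>"
      unfolding dual_def ev_plus by (simp add: fun_eq_iff)
    show "dual \<phi> \<in> cochains C"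
      by (simp add: dual_def cochains_def)
    show "dual (cobdry D \<phi>) = cobdry C (dual \<phi>)"
    proof
      fix b
      show "dual (cobdry D \<phi>) b = cobdry C (dual \<phi>) b"
        using f_keys[of b] bdry_total[OF C, of b] f_bdry[of "gen b"]
        by (auto simp: dual_def[of "cobdry D \<phi>"] cobdry_def[of C] ev_dual ev_cobdry)
    qed
    show "dual (cup D \<phi> \<psi>) = cup C (dual \<phi>) (dual \<psi>)"
    proof
      fix b
      show "dual (cup D \<phi> \<psi>) b = cup C (dual \<phi>) (dual \<psi>) b"
      proof (cases "b \<in> basis C")
        case True
        have "dual (cup D \<phi> \<psi>) b = ev (outer \<phi> \<psi>) (tensor_map f f (comult C b))"
          using True hom f_keys[OF True] by (simp add: dual_def ev_cup coalg_hom_def)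
        also have "\<dots> = ev (outer (dual \<phi>) (dual \<psi>)) (comult C b)"
          unfolding ev_tensor_map using keys_comult[OF C True] by (rule outer_cong) (auto simp: dual_def)
        finally show ?thesis
          using True by (simp add: cup_def)
      qed (simp add: dual_def cup_def)
    qed
  next
    fix \<phi> assume "\<phi> \<in> cochains D" "cobdry D \<phi> = 0" "R.exact (dual \<phi>)"
    then show "S.exact \<phi>"
      using dual_inj by (auto simp: R.exact_def S.exact_def)
  next
    fix \<phi> assume "\<phi> \<in> cochains C" "cobdry C \<phi> = 0"
    then show "\<exists>\<psi>\<in>cochains D. \<exists>\<eta>\<in>cochains C. cobdry D \<psi> = 0 \<and> \<phi> = dual \<psi> + cobdry C \<eta>"
      using dual_surj by metis
  qed
qed

end

subsection \<open>Invariance under zig-zags\<close>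

definition square_bracket_trivial_coalg :: "'b chain_coalg \<Rightarrow> bool"
  where "square_bracket_trivial_coalg C \<longleftrightarrow>
    dg_algebra2.square_bracket_trivial (cup C) (cobdry C) (cochains C)"

lemma coalg_quasi_iso_iff:
  assumes "coalg_quasi_iso C D"
  shows "square_bracket_trivial_coalg C \<longleftrightarrow> square_bracket_trivial_coalg D"
proof -
  obtain f where "coalg_quasi_iso_map C D f"
    using assms by (auto simp: coalg_quasi_iso_def coalg_quasi_iso_map_def)
  then interpret Q: coalg_quasi_iso_map C D f .
  interpret dg_quasi_iso2 "cup D" "cobdry D" "cochains D" "cup C" "cobdry C" "cochains C" Q.dual
    by (rule Q.dg_quasi_iso2_dual)
  show ?thesis
    unfolding square_bracket_trivial_coalg_def using reflects preserves by blast
qed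

lemma same_homotopy_type_iff:
  assumes "same_homotopy_type TYPE('c) A B"
  shows "square_bracket_trivial_coalg A \<longleftrightarrow> square_bracket_trivial_coalg B"
proof -
  obtain C D :: "'c chain_coalg" where *: "coalg_quasi_iso A C \<or> coalg_quasi_iso C A"
       "equivclp coalg_quasi_iso C D" "coalg_quasi_iso D B \<or> coalg_quasi_iso B D"
    using assms by (auto simp: same_homotopy_type_def)
  have "square_bracket_trivial_coalg C \<longleftrightarrow> square_bracket_trivial_coalg D"
    using *(2) by (induction rule: equivclp_induct) (auto dest: coalg_quasi_iso_iff)
  then show ?thesis
    using *(1,3) coalg_quasi_iso_iff by metis
qed

section \<open>The cup-1 product on the faces of a simplex\<close>

text \<open>For a fixed singular simplex a cochain becomes a function of faces, that is, of finite non-empty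
  sets of vertices, and the operations on cochains become sums over vertices. Faces of a face are then
  intersections, so no renumbering of vertices occurs. The face spanned by a single vertex has no
  boundary.\<close>

definition face_cobdry :: "(nat set \<Rightarrow> bit) \<Rightarrow> nat set \<Rightarrow> bit"
  where "face_cobdry g S = (if card S \<le> 1 then 0 else \<Sum>k\<in>S. g (S - {k}))"

definition face_cup :: "(nat set \<Rightarrow> bit) \<Rightarrow> (nat set \<Rightarrow> bit) \<Rightarrow> nat set \<Rightarrow> bit"
  where "face_cup g h S = (\<Sum>k\<in>S. g (S \<inter> {..k}) * h (S \<inter> {k..}))"

text \<open>Steenrod's cup-1 product: the vertex set is cut at \<open>k < l\<close>, the inner interval goes to the second
  factor and the two outer intervals, joined, to the first. Equality \<open>k = l\<close> is excluded, since it
  corresponds to a degenerate simplex in the first factor.\<close>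

definition face_cup1 :: "(nat set \<Rightarrow> bit) \<Rightarrow> (nat set \<Rightarrow> bit) \<Rightarrow> nat set \<Rightarrow> bit"
  where "face_cup1 g h S = (\<Sum>k\<in>S. \<Sum>l\<in>S \<inter> {k<..}. g (S \<inter> ({..k} \<union> {l..})) * h (S \<inter> {k..l}))"

lemma face_cup1_if:
  assumes "finite S"
  shows "face_cup1 g h S = (\<Sum>k\<in>S. \<Sum>l\<in>S. if k < l then g (S \<inter> ({..k} \<union> {l..})) * h (S \<inter> {k..l}) else 0)"
  unfolding face_cup1_def using assms by (simp add: sum.inter_restrict)

text \<open>A cut point \<open>j\<close> of the union of the two outer intervals lies in the lower or in the upper one. In the first
  case the first factor \<open>a\<close> is separated from the cup-1 product of \<open>b\<close> and \<open>c\<close>, in the second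
  case \<open>b\<close> is separated from that of \<open>a\<close> and \<open>c\<close>.\<close>

lemma hirsch_faces:
  assumes S: "finite S"
  shows "face_cup1 (face_cup a b) c S = face_cup a (face_cup1 b c) S + face_cup (face_cup1 a c) b S"
proof -
  let ?F = "\<lambda>j k l. if k < l \<and> (j \<le> k \<or> l \<le> j) then
    a (S \<inter> ({..k} \<union> {l..}) \<inter> {..j}) * b (S \<inter> ({..k} \<union> {l..}) \<inter> {j..}) * c (S \<inter> {k..l}) else 0"
  let ?F1 = "\<lambda>j k l. if j \<le> k \<and> k < l then
    a (S \<inter> {..j}) * b (S \<inter> {j..} \<inter> ({..k} \<union> {l..})) * c (S \<inter> {j..} \<inter> {k..l}) else 0"
  let ?F2 = "\<lambda>j k l. if k < l \<and> l \<le> j then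
    a (S \<inter> {..j} \<inter> ({..k} \<union> {l..})) * c (S \<inter> {..j} \<inter> {k..l}) * b (S \<inter> {j..}) else 0"
  have "face_cup1 (face_cup a b) c S = (\<Sum>k\<in>S. \<Sum>l\<in>S. \<Sum>j\<in>S. ?F j k l)"
    unfolding face_cup1_if[OF S] face_cup_def using S
    by (intro sum.cong refl) (simp add: sum.inter_restrict sum_distrib_right if_distrib[of "\<lambda>x. x * _"] cong: if_cong)
  also have "\<dots> = (\<Sum>k\<in>S. \<Sum>j\<in>S. \<Sum>l\<in>S. ?F j k l)"
    by (rule sum.cong[OF refl], rule sum.swap)
  also have "\<dots> = (\<Sum>j\<in>S. \<Sum>k\<in>S. \<Sum>l\<in>S. ?F j k l)"
    by (rule sum.swap)
  also have "\<dots> = (\<Sum>j\<in>S. \<Sum>k\<in>S. \<Sum>l\<in>S. ?F1 j k l + ?F2 j k l)"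
  proof (intro sum.cong refl)
    fix j k l
    have "j \<le> k \<Longrightarrow> k < l \<Longrightarrow> S \<inter> ({..k} \<union> {l..}) \<inter> {..j} = S \<inter> {..j}"
      "j \<le> k \<Longrightarrow> S \<inter> {j..} \<inter> {k..l} = S \<inter> {k..l}"
      "k < l \<Longrightarrow> l \<le> j \<Longrightarrow> S \<inter> ({..k} \<union> {l..}) \<inter> {j..} = S \<inter> {j..}"
      "l \<le> j \<Longrightarrow> S \<inter> {..j} \<inter> {k..l} = S \<inter> {k..l}"
      "S \<inter> ({..k} \<union> {l..}) \<inter> {j..} = S \<inter> {j..} \<inter> ({..k} \<union> {l..})"
      "S \<inter> ({..k} \<union> {l..}) \<inter> {..j} = S \<inter> {..j} \<inter> ({..k} \<union> {l..})"
      by auto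
    then show "?F j k l = ?F1 j k l + ?F2 j k l"
      by (cases "k < l"; cases "j \<le> k"; cases "l \<le> j") (simp_all add: mult_ac)
  qed
  also have "\<dots> = (\<Sum>j\<in>S. \<Sum>k\<in>S. \<Sum>l\<in>S. ?F1 j k l) + (\<Sum>j\<in>S. \<Sum>k\<in>S. \<Sum>l\<in>S. ?F2 j k l)"
    by (simp add: sum.distrib)
  also have "(\<Sum>j\<in>S. \<Sum>k\<in>S. \<Sum>l\<in>S. ?F1 j k l) = face_cup a (face_cup1 b c) S"
    unfolding face_cup_def
  proof (intro sum.cong refl)
    fix j
    have "a (S \<inter> {..j}) * face_cup1 b c (S \<inter> {j..})
      = (\<Sum>k\<in>S. \<Sum>l\<in>S. a (S \<inter> {..j}) * (if j \<le> k then if j \<le> l then if k < l then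
          b (S \<inter> {j..} \<inter> ({..k} \<union> {l..})) * c (S \<inter> {j..} \<inter> {k..l}) else 0 else 0 else 0))"
      using S by (simp add: face_cup1_if sum.inter_restrict sum_distrib_left) (auto simp: sum_distrib_left intro!: sum.cong)
    also have "\<dots> = (\<Sum>k\<in>S. \<Sum>l\<in>S. ?F1 j k l)"
      by (intro sum.cong refl) (auto simp: mult_ac)
    finally show "(\<Sum>k\<in>S. \<Sum>l\<in>S. ?F1 j k l) = a (S \<inter> {..j}) * face_cup1 b c (S \<inter> {j..})" ..
  qed
  also have "(\<Sum>j\<in>S. \<Sum>k\<in>S. \<Sum>l\<in>S. ?F2 j k l) = face_cup (face_cup1 a c) b S"
    unfolding face_cup_def
  proof (intro sum.cong refl)
    fix j
    have "face_cup1 a c (S \<inter> {..j}) * b (S \<inter> {j..})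
      = (\<Sum>k\<in>S. \<Sum>l\<in>S. (if k \<le> j then if l \<le> j then if k < l then
          a (S \<inter> {..j} \<inter> ({..k} \<union> {l..})) * c (S \<inter> {..j} \<inter> {k..l}) else 0 else 0 else 0) * b (S \<inter> {j..}))"
      using S by (simp add: face_cup1_if sum.inter_restrict sum_distrib_right) (auto simp: sum_distrib_right intro!: sum.cong)
    also have "\<dots> = (\<Sum>k\<in>S. \<Sum>l\<in>S. ?F2 j k l)"
      by (intro sum.cong refl) auto
    finally show "(\<Sum>k\<in>S. \<Sum>l\<in>S. ?F2 j k l) = face_cup1 a c (S \<inter> {..j}) * b (S \<inter> {j..})" ..
  qed
  finally show ?thesis .
qed

lemma bit_transpose: "(p::bit) + q + r = s + t \<Longrightarrow> p = q + r + t + s"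
  by (cases p; cases q; cases r; cases s; cases t) simp_all

lemma telescope_below: "(\<Sum>k<l. f k + f (Suc k)) = f 0 + (f l :: bit)"
  by (induction l) (simp_all add: ac_simps)

lemma telescope_above: "k \<le> n \<Longrightarrow> (\<Sum>l\<in>{k<..n}. f l + f (Suc l)) = f (Suc k) + (f (Suc n) :: bit)"
proof (induction n rule: dec_induct)
  case (step n)
  then have "{k<..Suc n} = insert (Suc n) {k<..n}"
    by auto
  then show ?case
    using step by (simp add: ac_simps)
qed simp

text \<open>The terms on both sides are indexed by a cut \<open>k < l\<close> and a deleted vertex \<open>m\<close>. For \<open>m\<close> different from
  \<open>k\<close> and \<open>l\<close> they cancel in pairs. For \<open>m = k\<close> and \<open>m = l\<close> the four remaining terms form two
  telescoping sums, over \<open>k\<close> with \<open>l\<close> fixed and over \<open>l\<close> with \<open>k\<close> fixed. The outer ends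
  \<open>F 0 l\<close> and \<open>G k (Suc n)\<close> give the two cup products, and the inner ends \<open>F k k = G k (Suc k)\<close>
  cancel.\<close>

lemma cup1_leibniz_faces:
  "face_cobdry (face_cup1 a b) {..n} =
    face_cup1 (face_cobdry a) b {..n} + face_cup1 a (face_cobdry b) {..n}
    + face_cup a b {..n} + face_cup b a {..n}"
proof (cases "n = 0")
  case True
  then show ?thesis
    by (simp add: face_cobdry_def face_cup_def face_cup1_if mult.commute)
next
  case False
  let ?S = "{..n}"
  let ?A = "\<lambda>k l. ?S \<inter> ({..k} \<union> {l..})" and ?B = "\<lambda>k l. ?S \<inter> {k..l}"
  let ?t0 = "\<lambda>m k l. if m \<noteq> k \<and> m \<noteq> l then a (?A k l - {m}) * b (?B k l - {m}) else 0"
  let ?t1 = "\<lambda>m k l. if m \<le> k \<or> l \<le> m then a (?A k l - {m}) * b (?B k l) else 0"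
  let ?t2 = "\<lambda>m k l. if k \<le> m \<and> m \<le> l then a (?A k l) * b (?B k l - {m}) else 0"
  define F where "F k l = a ({..<k} \<union> {l..n}) * b {k..l}" for k l
  define G where "G k l = a ({..k} \<union> {l..n}) * b {k..<l}" for k l
  have 0: "face_cobdry (face_cup1 a b) ?S = (\<Sum>k\<le>n. \<Sum>l\<le>n. if k < l then \<Sum>m\<le>n. ?t0 m k l else 0)"
  proof -
    have "face_cobdry (face_cup1 a b) ?S = (\<Sum>m\<le>n. \<Sum>k\<le>n. \<Sum>l\<le>n. if k < l then ?t0 m k l else 0)"
      unfolding face_cobdry_def
    proof (subst if_not_P, use False in simp, intro sum.cong refl)
      fix m
      have *: "(?S - {m}) \<inter> X = ?S \<inter> X - {m}" for X
        by auto
      have sum_diff: "(\<Sum>k\<in>?S - {m}. f k) = (\<Sum>k\<le>n. if k \<noteq> m then f k else 0)" for f :: "nat \<Rightarrow> bit"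
        by (rule sum.mono_neutral_cong_left) auto
      show "face_cup1 a b (?S - {m}) = (\<Sum>k\<le>n. \<Sum>l\<le>n. if k < l then ?t0 m k l else 0)"
        unfolding face_cup1_if[OF finite_Diff[OF finite_atMost]] sum_diff *
      proof (rule sum.cong[OF refl])
        fix k
        show "(if k \<noteq> m then \<Sum>l\<le>n. if l \<noteq> m then if k < l then a (?A k l - {m}) * b (?B k l - {m}) else 0 else 0 else 0)
            = (\<Sum>l\<le>n. if k < l then ?t0 m k l else 0)"
        proof (cases "k = m")
          case True
          have "(if k < l then ?t0 m k l else 0) = 0" for l
            using True by simp
          then show ?thesis
            using True by simp
        qed (auto intro!: sum.cong)
      qed
    qed
    also have "\<dots> = (\<Sum>k\<le>n. \<Sum>m\<le>n. \<Sum>l\<le>n. if k < l then ?t0 m k l else 0)"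
      by (rule sum.swap)
    also have "\<dots> = (\<Sum>k\<le>n. \<Sum>l\<le>n. \<Sum>m\<le>n. if k < l then ?t0 m k l else 0)"
      by (rule sum.cong[OF refl], rule sum.swap)
    also have "\<dots> = (\<Sum>k\<le>n. \<Sum>l\<le>n. if k < l then \<Sum>m\<le>n. ?t0 m k l else 0)"
      by (intro sum.cong refl) auto
    finally show ?thesis .
  qed
  have card2: "\<not> card X \<le> 1" if "k < l" "k \<in> X" "l \<in> X" "finite X" for k l :: nat and X
    using that by (metis One_nat_def card_le_Suc0_iff_eq nat_neq_iff)
  have 1: "face_cup1 (face_cobdry a) b ?S = (\<Sum>k\<le>n. \<Sum>l\<le>n. if k < l then \<Sum>m\<le>n. ?t1 m k l else 0)"
    unfolding face_cup1_if[OF finite_atMost]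
  proof (intro sum.cong refl if_cong)
    fix k l assume kl: "k \<in> ?S" "l \<in> ?S" "k < l"
    have "\<not> card (?A k l) \<le> 1"
      by (rule card2[of k l]) (use kl in auto)
    then have "face_cobdry a (?A k l) = (\<Sum>m\<in>?A k l. a (?A k l - {m}))"
      unfolding face_cobdry_def by (rule if_not_P)
    also have "\<dots> = (\<Sum>m\<le>n. if m \<le> k \<or> l \<le> m then a (?A k l - {m}) else 0)"
      by (simp add: sum.inter_restrict)
    finally show "face_cobdry a (?A k l) * b (?B k l) = (\<Sum>m\<le>n. ?t1 m k l)"
      by (simp add: sum_distrib_right) (auto intro!: sum.cong)
  qed
  have 2: "face_cup1 a (face_cobdry b) ?S = (\<Sum>k\<le>n. \<Sum>l\<le>n. if k < l then \<Sum>m\<le>n. ?t2 m k l else 0)"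
    unfolding face_cup1_if[OF finite_atMost]
  proof (intro sum.cong refl if_cong)
    fix k l assume kl: "k \<in> ?S" "l \<in> ?S" "k < l"
    have "\<not> card (?B k l) \<le> 1"
      by (rule card2[of k l]) (use kl in auto)
    then have "face_cobdry b (?B k l) = (\<Sum>m\<in>?B k l. b (?B k l - {m}))"
      unfolding face_cobdry_def by (rule if_not_P)
    also have "\<dots> = (\<Sum>m\<le>n. if k \<le> m \<and> m \<le> l then b (?B k l - {m}) else 0)"
      by (simp only: sum.inter_restrict[OF finite_atMost] atLeastAtMost_iff)
    finally show "a (?A k l) * face_cobdry b (?B k l) = (\<Sum>m\<le>n. ?t2 m k l)"
      by (simp add: sum_distrib_left) (auto intro!: sum.cong)
  qed
  have inner: "(\<Sum>m\<le>n. ?t0 m k l) + (\<Sum>m\<le>n. ?t1 m k l) + (\<Sum>m\<le>n. ?t2 m k l)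
      = (F k l + F (Suc k) l) + (G k l + G k (Suc l))"
    if kl: "k \<le> n" "l \<le> n" "k < l" for k l
  proof -
    let ?r = "\<lambda>m. a (?A k l - {m}) * b (?B k l) + a (?A k l) * b (?B k l - {m})"
    have "?t0 m k l + ?t1 m k l + ?t2 m k l = (if m = k then ?r k else 0) + (if m = l then ?r l else 0)" for m
    proof -
      consider "m < k \<or> l < m" | "m = k" | "m = l" | "k < m \<and> m < l"
        by linarith
      then show ?thesis
      proof cases
        case 1
        then have "?B k l - {m} = ?B k l"
          by auto
        then show ?thesis
          using 1 kl by auto
      next
        case 4
        then have "?A k l - {m} = ?A k l"
          by auto
        then show ?thesis
          using 4 kl by auto
      qed (use kl in auto)
    qed
    then have "(\<Sum>m\<le>n. ?t0 m k l) + (\<Sum>m\<le>n. ?t1 m k l) + (\<Sum>m\<le>n. ?t2 m k l) = ?r k + ?r l"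
      unfolding sum.distrib[symmetric] using kl by (simp only: sum.distrib) (simp add: sum.delta)
    moreover have "a (?A k l - {k}) = a ({..<k} \<union> {l..n})" "a (?A k l - {l}) = a ({..k} \<union> {Suc l..n})"
      "a (?A k l) = a ({..k} \<union> {l..n})" "a ({..<Suc k} \<union> {l..n}) = a ({..k} \<union> {l..n})"
      "b (?B k l - {k}) = b {Suc k..l}" "b (?B k l - {l}) = b {k..<l}" "b (?B k l) = b {k..l}"
      "b {k..<Suc l} = b {k..l}"
      by (rule arg_cong[of _ _ a] arg_cong[of _ _ b], use kl in auto)+
    ultimately show ?thesis
      unfolding F_def G_def by (simp only: add.assoc add.commute add.left_commute)
  qed
  have "face_cobdry (face_cup1 a b) ?S + face_cup1 (face_cobdry a) b ?S + face_cup1 a (face_cobdry b) ?S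
      = (\<Sum>k\<le>n. \<Sum>l\<le>n. if k < l then (F k l + F (Suc k) l) + (G k l + G k (Suc l)) else 0)"
    unfolding 0 1 2 sum.distrib[symmetric]
    by (intro sum.cong refl) (use inner in \<open>simp add: sum.distrib\<close>)
  also have "\<dots> = (\<Sum>k\<le>n. \<Sum>l\<le>n. if k < l then F k l + F (Suc k) l else 0)
      + (\<Sum>k\<le>n. \<Sum>l\<le>n. if k < l then G k l + G k (Suc l) else 0)"
    unfolding sum.distrib[symmetric] by (intro sum.cong refl) auto
  also have "(\<Sum>k\<le>n. \<Sum>l\<le>n. if k < l then F k l + F (Suc k) l else 0)
      = (\<Sum>l\<le>n. \<Sum>k\<le>n. if k < l then F k l + F (Suc k) l else 0)"
    by (rule sum.swap)
  also have "\<dots> = (\<Sum>l\<le>n. F 0 l + F l l)"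
  proof (rule sum.cong[OF refl])
    fix l assume "l \<in> ?S"
    then have "(\<Sum>k\<le>n. if k < l then F k l + F (Suc k) l else 0) = (\<Sum>k<l. F k l + F (Suc k) l)"
      by (intro sum.mono_neutral_cong_right) auto
    then show "(\<Sum>k\<le>n. if k < l then F k l + F (Suc k) l else 0) = F 0 l + F l l"
      by (simp only: telescope_below[of "\<lambda>k. F k l"])
  qed
  also have "(\<Sum>k\<le>n. \<Sum>l\<le>n. if k < l then G k l + G k (Suc l) else 0)
      = (\<Sum>k\<le>n. G k (Suc k) + G k (Suc n))"
  proof (rule sum.cong[OF refl])
    fix k assume k: "k \<in> ?S"
    then have "(\<Sum>l\<le>n. if k < l then G k l + G k (Suc l) else 0) = (\<Sum>l\<in>{k<..n}. G k l + G k (Suc l))"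
      by (intro sum.mono_neutral_cong_right) auto
    then show "(\<Sum>l\<le>n. if k < l then G k l + G k (Suc l) else 0) = G k (Suc k) + G k (Suc n)"
      using k by (simp only: telescope_above[of k n "G k"] atMost_iff)
  qed
  also have "(\<Sum>l\<le>n. F 0 l + F l l) + (\<Sum>k\<le>n. G k (Suc k) + G k (Suc n))
      = (\<Sum>l\<le>n. F 0 l) + (\<Sum>k\<le>n. G k (Suc n)) + ((\<Sum>l\<le>n. F l l) + (\<Sum>k\<le>n. G k (Suc k)))"
    by (simp add: sum.distrib ac_simps)
  also have "(\<Sum>k\<le>n. G k (Suc k)) = (\<Sum>l\<le>n. F l l)"
  proof (rule sum.cong[OF refl])
    fix k assume "k \<in> ?S"
    then have "{..k} \<union> {Suc k..n} = {..n}" "{..<k} \<union> {k..n} = {..n}" "{k..<Suc k} = {k..k}"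
      by auto
    then show "G k (Suc k) = F k k"
      by (simp only: F_def G_def)
  qed
  also have "(\<Sum>l\<le>n. F 0 l) = face_cup b a ?S"
    unfolding face_cup_def
  proof (rule sum.cong[OF refl])
    fix l assume "l \<in> ?S"
    then have "?S \<inter> {..l} = {0..l}" "?S \<inter> {l..} = {..<0} \<union> {l..n}"
      by auto
    then show "F 0 l = b (?S \<inter> {..l}) * a (?S \<inter> {l..})"
      by (simp only: F_def mult.commute)
  qed
  also have "(\<Sum>k\<le>n. G k (Suc n)) = face_cup a b ?S"
    unfolding face_cup_def
  proof (rule sum.cong[OF refl])
    fix k assume "k \<in> ?S"
    then have "?S \<inter> {..k} = {..k} \<union> {Suc n..n}" "?S \<inter> {k..} = {k..<Suc n}"
      by auto
    then show "G k (Suc n) = a (?S \<inter> {..k}) * b (?S \<inter> {k..})"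
      by (simp only: G_def)
  qed
  finally have "face_cobdry (face_cup1 a b) ?S + face_cup1 (face_cobdry a) b ?S + face_cup1 a (face_cobdry b) ?S
      = face_cup b a ?S + face_cup a b ?S"
    by (simp only: bit_double add_0_right)
  then show ?thesis
    by (rule bit_transpose)
qed

section \<open>Faces of singular simplices\<close>

text \<open>On a finite set \<open>S\<close> this is the order isomorphism onto an initial segment of the natural numbers,
  so it renumbers the vertices of the face \<open>S\<close> as those of a standard simplex, and \<open>ranked S\<close> undoes
  the renumbering for faces of that face.\<close>

definition vertex_rank :: "nat set \<Rightarrow> nat \<Rightarrow> nat"
  where "vertex_rank S v = card (S \<inter> {..<v})"

definition ranked :: "nat set \<Rightarrow> nat set \<Rightarrow> nat set"
  where "ranked S T = {v \<in> S. vertex_rank S v \<in> T}"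

lemma rank_less:
  assumes "finite S" "v \<in> S" "v < w"
  shows "vertex_rank S v < vertex_rank S w"
  unfolding vertex_rank_def using assms by (intro psubset_card_mono) auto

lemma rank_less_iff: "finite S \<Longrightarrow> v \<in> S \<Longrightarrow> w \<in> S \<Longrightarrow> vertex_rank S v < vertex_rank S w \<longleftrightarrow> v < w"
  using rank_less by (metis less_asym' linorder_neqE_nat)

lemma rank_le_iff: "finite S \<Longrightarrow> v \<in> S \<Longrightarrow> w \<in> S \<Longrightarrow> vertex_rank S v \<le> vertex_rank S w \<longleftrightarrow> v \<le> w"
  using rank_less_iff by (meson linorder_not_less)

lemma bij_rank:
  assumes "finite S"
  shows "bij_betw (vertex_rank S) S {..<card S}"
proof -
  have inj: "inj_on (vertex_rank S) S"
    using rank_less_iff[OF assms] by (metis inj_onI linorder_neqE_nat less_irrefl)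
  have "vertex_rank S v < card S" if "v \<in> S" for v
    unfolding vertex_rank_def using that assms by (intro psubset_card_mono) auto
  then have "vertex_rank S ` S = {..<card S}"
    using inj by (intro card_subset_eq) (auto simp: card_image)
  then show ?thesis
    using inj by (simp add: bij_betw_def)
qed

lemma rank_bound: "finite S \<Longrightarrow> v \<in> S \<Longrightarrow> vertex_rank S v < card S"
  using bij_rank[of S] by (auto simp: bij_betw_def)

lemma bij_ranked:
  assumes "finite S" "T \<subseteq> {..<card S}"
  shows "bij_betw (vertex_rank S) (ranked S T) T"
proof -
  have image: "vertex_rank S ` S = {..<card S}" and inj: "inj_on (vertex_rank S) S"
    using bij_rank[OF assms(1)] by (simp_all add: bij_betw_def)
  have "vertex_rank S ` ranked S T = vertex_rank S ` S \<inter> T"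
    unfolding ranked_def by blast
  also have "\<dots> = T"
    unfolding image using assms(2) by blast
  finally have "vertex_rank S ` ranked S T = T" .
  moreover have "inj_on (vertex_rank S) (ranked S T)"
    by (rule inj_on_subset[OF inj]) (auto simp: ranked_def)
  ultimately show ?thesis
    by (simp add: bij_betw_def)
qed

lemma card_ranked: "finite S \<Longrightarrow> T \<subseteq> {..<card S} \<Longrightarrow> card (ranked S T) = card T"
  using bij_ranked bij_betw_same_card by blast

lemma rank_ranked:
  assumes "finite S" "T \<subseteq> {..<card S}" "v \<in> S"
  shows "vertex_rank (ranked S T) v = vertex_rank T (vertex_rank S v)"
proof -
  have "T \<inter> {..<vertex_rank S v} \<subseteq> {..<card S}"
    using assms by auto
  then have "card (ranked S (T \<inter> {..<vertex_rank S v})) = card (T \<inter> {..<vertex_rank S v})"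
    by (rule card_ranked[OF assms(1)])
  moreover have "ranked S T \<inter> {..<v} = ranked S (T \<inter> {..<vertex_rank S v})"
    unfolding ranked_def using rank_less_iff[OF assms(1) _ assms(3)] by blast
  ultimately show ?thesis
    by (simp only: vertex_rank_def[of "ranked S T"] vertex_rank_def[of T])
qed

lemma
  assumes "finite S" "k \<in> S"
  shows ranked_delete: "ranked S ({..<card S} - {vertex_rank S k}) = S - {k}"
    and ranked_below: "ranked S ({..<card S} \<inter> {..vertex_rank S k}) = S \<inter> {..k}"
    and ranked_above: "ranked S ({..<card S} \<inter> {vertex_rank S k..}) = S \<inter> {k..}"
  using assms rank_bound[OF assms(1)] rank_le_iff[OF assms(1)]
    bij_betw_imp_inj_on[OF bij_rank[OF assms(1)]]
  by (auto simp: ranked_def inj_on_eq_iff)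

lemma ranked_between:
  assumes "finite S" "k \<in> S" "l \<in> S"
  shows "ranked S ({..<card S} \<inter> {vertex_rank S k..vertex_rank S l}) = S \<inter> {k..l}"
    and "ranked S ({..<card S} \<inter> ({..vertex_rank S k} \<union> {vertex_rank S l..})) = S \<inter> ({..k} \<union> {l..})"
  using assms rank_bound[OF assms(1)] rank_le_iff[OF assms(1)]
  by (auto simp: ranked_def)

subsection \<open>Operations on a face\<close>

lemma sum_rank:
  "finite S \<Longrightarrow> (\<Sum>i<card S. f i) = (\<Sum>k\<in>S. f (vertex_rank S k))"
  using sum.reindex_bij_betw[OF bij_rank, of S f] by simp

text \<open>The operations commute with passing to a face \<open>S\<close>: computing on the standard simplex with
  \<open>card S\<close> vertices or inside \<open>S\<close> gives the same. The empty set of vertices spans no singular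
  simplex.\<close>

lemma face_cobdry_ranked:
  assumes S: "finite S"
    and g: "\<And>T. T \<subseteq> {..<card S} \<Longrightarrow> T \<noteq> {} \<Longrightarrow> g' T = g (ranked S T)"
  shows "face_cobdry g' {..<card S} = face_cobdry g S"
proof (cases "card S \<le> 1")
  case False
  have "g' ({..<card S} - {vertex_rank S k}) = g (S - {k})" if "k \<in> S" for k
  proof -
    have ne: "{..<card S} - {vertex_rank S k} \<noteq> {}"
    proof
      assume "{..<card S} - {vertex_rank S k} = {}"
      then have "{..<card S} \<subseteq> {vertex_rank S k}"
        by blast
      then show False
        using False card_mono[of "{vertex_rank S k}" "{..<card S}"] by simp
    qed
    then show ?thesis
      using g[OF Diff_subset ne] ranked_delete[OF S that] by simp
  qed
  then show ?thesis
    using False by (simp add: face_cobdry_def sum_rank[OF S])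
qed (simp add: face_cobdry_def)

context
  fixes S :: "nat set" and g g' h h' :: "nat set \<Rightarrow> bit"
  assumes S: "finite S"
    and g: "\<And>T. T \<subseteq> {..<card S} \<Longrightarrow> T \<noteq> {} \<Longrightarrow> g' T = g (ranked S T)"
    and h: "\<And>T. T \<subseteq> {..<card S} \<Longrightarrow> T \<noteq> {} \<Longrightarrow> h' T = h (ranked S T)"
begin

lemma
  assumes "i < card S" "i \<in> A"
  shows face_value_left: "g' ({..<card S} \<inter> A) = g (ranked S ({..<card S} \<inter> A))"
    and face_value_right: "h' ({..<card S} \<inter> A) = h (ranked S ({..<card S} \<inter> A))"
  using assms by (auto intro!: g h)

lemma face_cup_ranked: "face_cup g' h' {..<card S} = face_cup g h S"
  unfolding face_cup_def sum_rank[OF S]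
proof (rule sum.cong[OF refl])
  fix k assume k: "k \<in> S"
  show "g' ({..<card S} \<inter> {..vertex_rank S k}) * h' ({..<card S} \<inter> {vertex_rank S k..}) = g (S \<inter> {..k}) * h (S \<inter> {k..})"
    unfolding ranked_below[OF S k, symmetric] ranked_above[OF S k, symmetric]
    using face_value_left[OF rank_bound[OF S k], of "{..vertex_rank S k}"] face_value_right[OF rank_bound[OF S k], of "{vertex_rank S k..}"]
    by simp
qed

lemma face_cup1_ranked: "face_cup1 g' h' {..<card S} = face_cup1 g h S"
  unfolding face_cup1_if[OF S] face_cup1_if[OF finite_lessThan] sum_rank[OF S]
proof (intro sum.cong refl if_cong)
  fix k l assume k: "k \<in> S" and l: "l \<in> S"
  show "(vertex_rank S k < vertex_rank S l) = (k < l)"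
    using rank_less_iff S k l by blast
  assume "k < l"
  then have "vertex_rank S k \<in> {vertex_rank S k..vertex_rank S l}"
    using rank_le_iff[OF S k l] by simp
  then show "g' ({..<card S} \<inter> ({..vertex_rank S k} \<union> {vertex_rank S l..})) * h' ({..<card S} \<inter> {vertex_rank S k..vertex_rank S l})
      = g (S \<inter> ({..k} \<union> {l..})) * h (S \<inter> {k..l})"
    unfolding ranked_between[OF S k l, symmetric]
    using face_value_left[OF rank_bound[OF S k], of "{..vertex_rank S k} \<union> {vertex_rank S l..}"]
      face_value_right[OF rank_bound[OF S k], of "{vertex_rank S k..vertex_rank S l}"]
    by simp
qed

end

subsection \<open>The face spanned by a set of vertices\<close>

definition place :: "nat set \<Rightarrow> (nat \<Rightarrow> real) \<Rightarrow> nat \<Rightarrow> real"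
  where "place S t = (\<lambda>v. if v \<in> S then t (vertex_rank S v) else 0)"

definition face :: "nat set \<Rightarrow> ((nat \<Rightarrow> real) \<Rightarrow> 'a) \<Rightarrow> (nat \<Rightarrow> real) \<Rightarrow> 'a"
  where "face S s = restrict (s \<circ> place S) (standard_simplex (card S - 1))"

lemma place_in_simplex:
  assumes S: "S \<subseteq> {..n}" "S \<noteq> {}" and t: "t \<in> standard_simplex (card S - 1)"
  shows "place S t \<in> standard_simplex n"
proof -
  have fin: "finite S"
    using S finite_subset by blast
  have "(\<Sum>v\<le>n. place S t v) = (\<Sum>v\<in>S. t (vertex_rank S v))"
    unfolding place_def using S(1) by (intro sum.mono_neutral_cong_right) auto
  also have "\<dots> = (\<Sum>i<card S. t i)"
    by (simp add: sum_rank[OF fin])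
  also have "{..<card S} = {..card S - 1}"
    using fin S(2) by (simp add: card_gt_0_iff flip: lessThan_Suc_atMost)
  finally have "(\<Sum>v\<le>n. place S t v) = (\<Sum>i\<le>card S - 1. t i)" .
  moreover have "place S t v = 0" if "v > n" for v
    using S(1) that by (auto simp: place_def)
  moreover have "0 \<le> place S t v \<and> place S t v \<le> 1" for v
    using t by (simp add: place_def standard_simplex_def)
  ultimately show ?thesis
    using t unfolding standard_simplex_def by simp
qed

lemma place_place:
  assumes "finite S" "T \<subseteq> {..<card S}"
  shows "place S (place T t) = place (ranked S T) t"
  using rank_ranked[OF assms] by (auto simp: place_def ranked_def)

lemma face_face:
  assumes S: "finite S" and T: "T \<subseteq> {..<card S}" "T \<noteq> {}"
  shows "face T (face S s) = face (ranked S T) s"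
proof
  fix t
  have "T \<subseteq> {..card S - 1}"
    using T(1) by auto
  note * = place_in_simplex[OF this T(2)]
  show "face T (face S s) t = face (ranked S T) s t"
    unfolding face_def card_ranked[OF S T(1)] using *
    by (cases "t \<in> standard_simplex (card T - 1)") (simp_all add: place_place[OF S T(1)])
qed

lemma singular_simplex_face:
  assumes s: "singular_simplex n X s" and S: "S \<subseteq> {..n}" "S \<noteq> {}"
  shows "singular_simplex (card S - 1) X (face S s)"
proof -
  let ?D = "\<lambda>p. subtopology (powertop_real UNIV) (standard_simplex p)"
  have "continuous_map (powertop_real UNIV) (powertop_real UNIV) (place S)"
    unfolding continuous_map_componentwise_UNIV
  proof
    fix v
    show "continuous_map (powertop_real UNIV) euclideanreal (\<lambda>t. place S t v)"
      using continuous_map_product_projection[of "vertex_rank S v" UNIV "\<lambda>_. euclideanreal"]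
      by (cases "v \<in> S") (simp_all add: place_def)
  qed
  then have "continuous_map (?D (card S - 1)) (?D n) (place S)"
    unfolding continuous_map_in_subtopology topspace_standard_simplex
    using place_in_simplex[OF S] by (simp add: continuous_map_from_subtopology image_subset_iff)
  then have "continuous_map (?D (card S - 1)) X (s \<circ> place S)"
    by (rule continuous_map_compose) (use s in \<open>simp add: singular_simplex_def\<close>)
  then have "continuous_map (?D (card S - 1)) X (face S s)"
    by (rule continuous_map_eq) (simp add: face_def)
  then show ?thesis
    by (simp add: singular_simplex_def face_def)
qed

lemma face_eqI:
  assumes "\<And>t. t \<in> standard_simplex (card S - 1) \<Longrightarrow> place S t = F t"
  shows "face S s = restrict (s \<circ> F) (standard_simplex (card S - 1))"
  using assms by (auto simp: face_def restrict_def)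

lemma rank_interval: "v \<in> {i..j} \<Longrightarrow> vertex_rank {i..j} v = v - i"
proof -
  assume "v \<in> {i..j}"
  then have "{i..j} \<inter> {..<v} = {i..<v}"
    by auto
  then show ?thesis
    by (simp add: vertex_rank_def)
qed

lemma front_face_eq: "front_face i s = face {..i} s"
proof -
  have "place {..i} t = t" if "t \<in> standard_simplex i" for t
    using that rank_interval[of _ 0 i] by (auto simp: place_def standard_simplex_def atLeast0AtMost)
  then show ?thesis
    using face_eqI[of "{..i}" "\<lambda>t. t" s] by (simp add: front_face_def o_def)
qed

lemma back_face_eq: "back_face i m s = face {i..i + m} s"
proof -
  have "place {i..i + m} t = (\<lambda>k. if k < i then 0 else t (k - i))" if "t \<in> standard_simplex m" for t
    using that rank_interval[of _ i "i + m"] by (auto simp: place_def standard_simplex_def)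
  then show ?thesis
    using face_eqI[of "{i..i + m}" "\<lambda>t k. if k < i then 0 else t (k - i)" s]
    by (simp add: back_face_def o_def)
qed

lemma singular_face_eq:
  assumes "n > 0" "k \<le> n"
  shows "singular_face n k s = face ({..n} - {k}) s"
proof -
  have card: "card ({..n} - {k}) - Suc 0 = n - Suc 0"
    using assms by simp
  have "place ({..n} - {k}) t = simplical_face k t" if t: "t \<in> standard_simplex (n - Suc 0)" for t
  proof
    fix v
    have "({..n} - {k}) \<inter> {..<v} = {..<v} - {k}" if "v \<le> n"
      using that by auto
    then have vertex_rank: "vertex_rank ({..n} - {k}) v = (if k < v then v - 1 else v)" if "v \<le> n"
      using that by (simp add: vertex_rank_def card_Diff_singleton_if)
    show "place ({..n} - {k}) t v = simplical_face k t v"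
      using t vertex_rank assms by (auto simp: place_def simplical_face_def standard_simplex_def)
  qed
  then show ?thesis
    using face_eqI[of "{..n} - {k}" "simplical_face k" s] by (simp add: singular_face_def card)
qed

section \<open>Singular cochains\<close>

definition pull :: "(nat \<times> ((nat \<Rightarrow> real) \<Rightarrow> 'a) \<Rightarrow> bit) \<Rightarrow> ((nat \<Rightarrow> real) \<Rightarrow> 'a) \<Rightarrow> nat set \<Rightarrow> bit"
  where "pull \<phi> s S = \<phi> (card S - 1, face S s)"

definition cup1 :: "'a topology \<Rightarrow> (nat \<times> ((nat \<Rightarrow> real) \<Rightarrow> 'a) \<Rightarrow> bit) \<Rightarrow> (nat \<times> ((nat \<Rightarrow> real) \<Rightarrow> 'a) \<Rightarrow> bit)
    \<Rightarrow> nat \<times> ((nat \<Rightarrow> real) \<Rightarrow> 'a) \<Rightarrow> bit"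
  where "cup1 X \<phi> \<psi> = (\<lambda>(n, s). if singular_simplex n X s then face_cup1 (pull \<phi> s) (pull \<psi> s) {..n} else 0)"

lemma cobdry_singular:
  assumes "singular_simplex n X s"
  shows "cobdry (singular_coalg X) \<phi> (n, s) = face_cobdry (pull \<phi> s) {..n}"
proof (cases "n = 0")
  case False
  have "cobdry (singular_coalg X) \<phi> (n, s) = (\<Sum>k\<le>n. \<phi> (n - 1, singular_face n k s))"
    using assms False by (simp add: cobdry_def singular_coalg_def ev_bit_sum)
  also have "\<dots> = (\<Sum>k\<le>n. pull \<phi> s ({..n} - {k}))"
    using False by (intro sum.cong refl) (simp add: pull_def singular_face_eq)
  finally show ?thesis
    using False by (simp add: face_cobdry_def)
qed (use assms in \<open>simp add: cobdry_def singular_coalg_def face_cobdry_def\<close>)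

lemma cup_singular:
  assumes "singular_simplex n X s"
  shows "cup (singular_coalg X) \<phi> \<psi> (n, s) = face_cup (pull \<phi> s) (pull \<psi> s) {..n}"
proof -
  have "cup (singular_coalg X) \<phi> \<psi> (n, s)
      = (\<Sum>i\<le>n. \<phi> (i, front_face i s) * \<psi> (n - i, back_face i (n - i) s))"
    using assms by (simp add: cup_def singular_coalg_def ev_bit_sum outer_def)
  also have "\<dots> = (\<Sum>i\<le>n. pull \<phi> s ({..n} \<inter> {..i}) * pull \<psi> s ({..n} \<inter> {i..}))"
  proof (rule sum.cong[OF refl])
    fix i assume "i \<in> {..n}"
    then have "{..n} \<inter> {..i} = {..i}" "{..n} \<inter> {i..} = {i..i + (n - i)}"
      by auto
    then show "\<phi> (i, front_face i s) * \<psi> (n - i, back_face i (n - i) s)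
        = pull \<phi> s ({..n} \<inter> {..i}) * pull \<psi> s ({..n} \<inter> {i..})"
      by (simp only: pull_def front_face_eq back_face_eq) simp
  qed
  finally show ?thesis
    by (simp add: face_cup_def)
qed

subsection \<open>Operations on the faces of a singular simplex\<close>

context
  fixes X :: "'a topology" and n and s :: "(nat \<Rightarrow> real) \<Rightarrow> 'a" and S
  assumes s: "singular_simplex n X s" and S: "S \<subseteq> {..n}" "S \<noteq> {}"
begin

lemma finite_vertices: "finite S"
  using S finite_subset by blast

lemma atMost_card_vertices: "{..card S - 1} = {..<card S}"
  using S(2) finite_vertices by (simp add: card_gt_0_iff flip: lessThan_Suc_atMost)

lemma pull_face: "T \<subseteq> {..<card S} \<Longrightarrow> T \<noteq> {} \<Longrightarrow> pull \<phi> (face S s) T = pull \<phi> s (ranked S T)"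
  by (simp add: pull_def face_face[OF finite_vertices] card_ranked[OF finite_vertices])

lemma pull_cobdry: "pull (cobdry (singular_coalg X) \<phi>) s S = face_cobdry (pull \<phi> s) S"
  unfolding pull_def[of "cobdry _ _"] cobdry_singular[OF singular_simplex_face[OF s S]] atMost_card_vertices
  by (rule face_cobdry_ranked[OF finite_vertices]) (rule pull_face)

lemma pull_cup: "pull (cup (singular_coalg X) \<phi> \<psi>) s S = face_cup (pull \<phi> s) (pull \<psi> s) S"
  unfolding pull_def[of "cup _ _ _"] cup_singular[OF singular_simplex_face[OF s S]] atMost_card_vertices
  by (rule face_cup_ranked[OF finite_vertices]) (rule pull_face; assumption)+

lemma pull_cup1: "pull (cup1 X \<phi> \<psi>) s S = face_cup1 (pull \<phi> s) (pull \<psi> s) S"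
  unfolding pull_def[of "cup1 _ _ _"] unfolding cup1_def prod.case if_P[OF singular_simplex_face[OF s S]] atMost_card_vertices
  by (rule face_cup1_ranked[OF finite_vertices]) (rule pull_face; assumption)+

end

lemma face_cobdry_cong:
  assumes "\<And>T. T \<subseteq> S \<Longrightarrow> T \<noteq> {} \<Longrightarrow> g T = g' T"
  shows "face_cobdry g S = face_cobdry g' S"
proof -
  have "S - {k} \<noteq> {}" if "\<not> card S \<le> 1" for k
    using that card_mono[of "{k}" S] by auto
  then show ?thesis
    unfolding face_cobdry_def using assms by (auto intro!: sum.cong)
qed

lemma face_cup_cong:
  assumes "\<And>T. T \<subseteq> S \<Longrightarrow> T \<noteq> {} \<Longrightarrow> g T = g' T" "\<And>T. T \<subseteq> S \<Longrightarrow> T \<noteq> {} \<Longrightarrow> h T = h' T"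
  shows "face_cup g h S = face_cup g' h' S"
  unfolding face_cup_def by (intro sum.cong refl arg_cong2[of _ _ _ _ "(*)"] assms) auto

lemma face_cup1_cong:
  assumes "\<And>T. T \<subseteq> S \<Longrightarrow> T \<noteq> {} \<Longrightarrow> g T = g' T" "\<And>T. T \<subseteq> S \<Longrightarrow> T \<noteq> {} \<Longrightarrow> h T = h' T"
  shows "face_cup1 g h S = face_cup1 g' h' S"
  unfolding face_cup1_def by (intro sum.cong refl arg_cong2[of _ _ _ _ "(*)"] assms) auto

lemma outside_basis:
  assumes "\<not> singular_simplex n X s"
  shows "cobdry (singular_coalg X) \<phi> (n, s) = 0" "cup (singular_coalg X) \<phi> \<psi> (n, s) = 0" "cup1 X \<phi> \<psi> (n, s) = 0"
  using assms by (simp_all add: cobdry_def cup_def cup1_def singular_coalg_def)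

subsection \<open>The cup-1 product of singular cochains\<close>

lemma cup1_leibniz:
  "cobdry (singular_coalg X) (cup1 X \<phi> \<psi>) =
    cup1 X (cobdry (singular_coalg X) \<phi>) \<psi> + cup1 X \<phi> (cobdry (singular_coalg X) \<psi>)
    + cup (singular_coalg X) \<phi> \<psi> + cup (singular_coalg X) \<psi> \<phi>" (is "?l = ?r")
proof
  fix b :: "nat \<times> ((nat \<Rightarrow> real) \<Rightarrow> 'a)"
  obtain n s where b: "b = (n, s)"
    by fastforce
  show "?l b = ?r b"
  proof (cases "singular_simplex n X s")
    case s: True
    have "?l b = face_cobdry (face_cup1 (pull \<phi> s) (pull \<psi> s)) {..n}"
      unfolding b cobdry_singular[OF s] by (rule face_cobdry_cong) (rule pull_cup1[OF s])
    moreover have "cup1 X (cobdry (singular_coalg X) \<phi>) \<psi> b = face_cup1 (face_cobdry (pull \<phi> s)) (pull \<psi> s) {..n}"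
      unfolding b cup1_def by (simp add: s) (rule face_cup1_cong, rule pull_cobdry[OF s], simp_all)
    moreover have "cup1 X \<phi> (cobdry (singular_coalg X) \<psi>) b = face_cup1 (pull \<phi> s) (face_cobdry (pull \<psi> s)) {..n}"
      unfolding b cup1_def by (simp add: s) (rule face_cup1_cong, simp, rule pull_cobdry[OF s])
    ultimately show ?thesis
      by (simp add: cup1_leibniz_faces cup_singular[OF s] b)
  qed (simp add: b outside_basis)
qed

lemma hirsch:
  "cup1 X (cup (singular_coalg X) \<phi> \<psi>) \<omega> =
    cup (singular_coalg X) \<phi> (cup1 X \<psi> \<omega>) + cup (singular_coalg X) (cup1 X \<phi> \<omega>) \<psi>" (is "?l = ?r")
proof
  fix b :: "nat \<times> ((nat \<Rightarrow> real) \<Rightarrow> 'a)"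
  obtain n s where b: "b = (n, s)"
    by fastforce
  show "?l b = ?r b"
  proof (cases "singular_simplex n X s")
    case s: True
    have "?l b = face_cup1 (face_cup (pull \<phi> s) (pull \<psi> s)) (pull \<omega> s) {..n}"
      unfolding b cup1_def by (simp add: s) (rule face_cup1_cong, rule pull_cup[OF s], simp_all)
    moreover have "cup (singular_coalg X) \<phi> (cup1 X \<psi> \<omega>) b = face_cup (pull \<phi> s) (face_cup1 (pull \<psi> s) (pull \<omega> s)) {..n}"
      unfolding b cup_singular[OF s] by (rule face_cup_cong, simp, rule pull_cup1[OF s])
    moreover have "cup (singular_coalg X) (cup1 X \<phi> \<omega>) \<psi> b = face_cup (face_cup1 (pull \<phi> s) (pull \<omega> s)) (pull \<psi> s) {..n}"
      unfolding b cup_singular[OF s] by (rule face_cup_cong, rule pull_cup1[OF s], simp_all)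
    ultimately show ?thesis
      by (simp add: hirsch_faces)
  qed (simp add: b outside_basis)
qed

lemma cup1_cochain: "cup1 X \<phi> \<psi> \<in> cochains (singular_coalg X)"
  by (auto simp: cochains_def cup1_def singular_coalg_def)

lemma cup1_0: "cup1 X 0 \<psi> = 0" "cup1 X \<phi> 0 = 0"
  by (auto simp: cup1_def fun_eq_iff face_cup1_def pull_def)

text \<open>With \<open>h\<close> the cup-1 product, \<open>d (h x z) = h (u\<^sup>2) z + [x, z]\<close>, and the Hirsch formula evaluates
  \<open>h (u\<^sup>2) z = [u, h u z]\<close>. So \<open>[x, z] + [u, c]\<close> is cohomologous to \<open>[u, c + h u z]\<close>, a commutator of
  cocycles, which bounds \<open>h u (c + h u z)\<close>.\<close>

lemma singular_square_bracket_trivial: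
  assumes "chain_coalgebra (singular_coalg X)"
  shows "square_bracket_trivial_coalg (singular_coalg X)"
proof -
  interpret dg_algebra2 "cup (singular_coalg X)" "cobdry (singular_coalg X)" "cochains (singular_coalg X)"
    by (rule dg_algebra2_cochains[OF assms])
  let ?d = "cobdry (singular_coalg X)" and ?m = "cup (singular_coalg X)" and ?h = "cup1 X"
  have d_cup1: "?d (?h \<phi> \<psi>) = ?h (?d \<phi>) \<psi> + ?h \<phi> (?d \<psi>) + lie \<phi> \<psi>" for \<phi> \<psi>
    by (simp add: cup1_leibniz lie_def add.assoc)
  have comm: "lie \<phi> \<psi> = ?d (?h \<phi> \<psi>)" if "?d \<phi> = 0" "?d \<psi> = 0" for \<phi> \<psi>
    using that by (simp add: d_cup1 cup1_0)
  have "lie x z + lie u c = ?d (?h x z + ?h u (c + ?h u z))"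
    if u: "?d u = 0" "?d z = 0" "?d x = ?m u u" "?d c = lie u z" for u z x c
  proof -
    have "?d (c + ?h u z) = 0"
      by (simp add: d_add u(4) comm[OF u(1,2), symmetric] char2)
    then have "?d (?h u (c + ?h u z)) = lie u (c + ?h u z)"
      using comm u(1) by simp
    moreover have "?d (?h x z) = lie u (?h u z) + lie x z"
      by (simp add: d_cup1 u hirsch cup1_0 lie_def)
    ultimately show ?thesis
      by (simp add: dg_simps)
  qed
  then show ?thesis
    unfolding square_bracket_trivial_coalg_def square_bracket_trivial_def exact_def
    using comm cup1_cochain K_add by meson
qed

section \<open>The coalgebra M is not realizable\<close>

definition dual_gen :: "M_basis \<Rightarrow> M_basis \<Rightarrow> bit"
  where "dual_gen b = (\<lambda>c. if c = b then 1 else 0)"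

lemma cobdry_M: "cobdry M_coalg \<phi> b = (if b = V4 then \<phi> X3 + \<phi> Y3 else 0)"
  by (simp add: cobdry_def M_coalg_def M_bdry_def)

lemma cup_M: "cup M_coalg \<phi> \<psi> b =
    (if b = One0 then \<phi> One0 * \<psi> One0
     else \<phi> b * \<psi> One0 + \<phi> One0 * \<psi> b
       + (if b = V4 then \<phi> U2 * \<psi> U2 else if b = W6 then \<phi> X3 * \<psi> Z3 + \<phi> Z3 * \<psi> Y3 else 0))"
  by (cases b) (simp_all add: cup_def M_coalg_def M_comult_def outer_def)

text \<open>The operation is non-zero on the classes dual to \<open>u\<close> and \<open>z\<close>: the square of the first is the
  coboundary of the dual of \<open>x\<close>, the two commute strictly, and the bracket of the duals of \<open>x\<close> and \<open>z\<close>
  is the dual of \<open>w\<close>, because \<open>x \<otimes> z\<close> occurs in the comultiplication of \<open>w\<close> and \<open>z \<otimes> x\<close> does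
  not.\<close>

lemma M_not_square_bracket_trivial:
  assumes "chain_coalgebra M_coalg"
  shows "\<not> square_bracket_trivial_coalg M_coalg"
proof
  interpret dg_algebra2 "cup M_coalg" "cobdry M_coalg" "cochains M_coalg"
    by (rule dg_algebra2_cochains[OF assms])
  assume "square_bracket_trivial_coalg M_coalg"
  moreover have "cobdry M_coalg (dual_gen U2) = 0" "cobdry M_coalg (dual_gen Z3) = 0"
    by (simp_all add: fun_eq_iff cobdry_M dual_gen_def)
  moreover have "cobdry M_coalg (dual_gen X3) = cup M_coalg (dual_gen U2) (dual_gen U2)"
    by (simp add: fun_eq_iff cobdry_M cup_M dual_gen_def)
  moreover have "cobdry M_coalg 0 = lie (dual_gen U2) (dual_gen Z3)"
    by (simp add: fun_eq_iff lie_def cup_M dual_gen_def)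
  moreover have "\<phi> \<in> cochains M_coalg" for \<phi>
    by (simp add: cochains_def M_coalg_def)
  ultimately have "exact (lie (dual_gen X3) (dual_gen Z3) + lie (dual_gen U2) 0)"
    unfolding square_bracket_trivial_coalg_def square_bracket_trivial_def by blast
  then obtain \<eta> where "lie (dual_gen X3) (dual_gen Z3) = cobdry M_coalg \<eta>"
    unfolding exact_def by (auto simp: lie_def)
  then have "lie (dual_gen X3) (dual_gen Z3) W6 = cobdry M_coalg \<eta> W6"
    by simp
  then show False
    by (simp add: lie_def cup_M cobdry_M dual_gen_def)
qed

lemma same_homotopy_type_chain_coalgebra:
  assumes "same_homotopy_type TYPE('c) A B"
  shows "chain_coalgebra A" "chain_coalgebra B"
  using assms by (auto simp: same_homotopy_type_def coalg_quasi_iso_def)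

theorem propositionA9:
  fixes X :: "'a topology"
  shows "\<not> same_homotopy_type TYPE('c) M_coalg (singular_coalg X)"
proof
  assume *: "same_homotopy_type TYPE('c) M_coalg (singular_coalg X)"
  show False
    using same_homotopy_type_iff[OF *] same_homotopy_type_chain_coalgebra[OF *]
      M_not_square_bracket_trivial singular_square_bracket_trivial by blast
qed

end
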